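(* For $t\in\{q,qa,qc,vect\}$ let $\Theta_t^s\subset\mathbb{R}^2$ be the set of all pairs $(\theta(p),\widetilde\theta(p))$, where $p$ ranges over the set $C_t^s(3,2)$ of synchronous correlations of type $t$ with three inputs and two outputs. For $\theta\in[0,1]$ put $$f_t^u(\theta)=\sup\{\widetilde\theta:(\theta,\widetilde\theta)\in\Theta_t^s\},\qquad f_t^l(\theta)=\inf\{\widetilde\theta:(\theta,\widetilde\theta)\in\Theta_t^s\}.$$ Then for $t\in\{q,qa,qc\}$ and $\theta\in[0,1]$, $$f_t^l(\theta)=\frac12,\qquad f_t^u(\theta)=\begin{cases}\frac12+\theta & \text{for } 0\le\theta\le\frac13,\\ \frac{3+\theta}{4} & \text{for } \frac13\le\theta\le\frac12,\\ \frac{4-\theta}{4} & \text{for } \frac12\le\theta\le\frac23,\\ \frac32-\theta & \text{for } \frac23\le\theta\le1.\end{cases}$$ Moreover, for $\theta\in[0,1]$, $$f_{vect}^l(\theta)=\frac12,\qquad f_{vect}^u(\theta)=\begin{cases}\frac12+\theta & \text{for } 0\le\theta\le\frac13,\\ \frac{1+3\theta-3\theta^2}{2} & \text{for } \frac13\le\theta\le\frac23,\\ \frac32-\theta & \text{for } \frac23\le\theta\le1.\end{cases}$$ In all of these cases (all $t\in\{q,qa,qc,vect\}$ and all $\theta\in[0,1]$) the supremum and the infimum are attained. Furthermore, $(\theta,\widetilde\theta)\in\Theta_t^s$ if and only if $0\le\theta\le1$ and $f_t^l(\theta)\le\widetilde\theta\le f_t^u(\theta)$; consequently $\Theta_t^s$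 is a closed subset of $\mathbb{R}^2$ for each $t\in\{q,qa,qc,vect\}$. In particular, $$\Theta_q^s=\Theta_{qa}^s=\Theta_{qc}^s\subsetneq\Theta_{vect}^s.$$
   Context: Let $I=\{0,\dots,n-1\}$ be the input set and $O=\{0,\dots,m-1\}$ the output set. A correlation is a tuple $p=(p(i,j|v,w))_{i,j\in O,\,v,w\in I}$ of nonnegative reals with $\sum_{i,j\in O}p(i,j|v,w)=1$ for all $v,w\in I$. A projection valued measure (PVM) on a Hilbert space is a family $\{P_i\}_{i\in O}$ of (orthogonal) projections with $\sum_iP_i=I$. - $C_q(n,m)$: all $p$ of the form $p(i,j|v,w)=\langle(P_{v,i}\otimes Q_{w,j})h,h\rangle$, where $\{P_{v,i}\}_{i\in O}$ ($v\in I$) are PVMs on a finite dimensional Hilbert space $\mathcal H_A$, $\{Q_{w,j}\}_{j\in O}$ ($w\in I$) are PVMs on a finite dimensional Hilbert space $\mathcal H_B$, and $h\in\mathcal H_A\otimes\mathcal H_B$ is a unit vector. - $C_{qa}(n,m)$: the closure of $C_q(n,m)$ in $\mathbb{R}^{n^2m^2}$. - $C_{qc}(n,m)$: all $p$ of the form $p(i,j|v,w)=\langle P_{v,i}Q_{w,j}h,h\rangle$, where $\{P_{v,i}\}_{i\in O}$ and $\{Q_{w,j}\}_{j\in O}$ ($v,w\in I$) are PVMs on a single (possibly infinite dimensional) Hilbert space $\mathcal H$ with $P_{v,i}Q_{w,j}=Q_{w,j}P_{v,i}$ for all $v,w,i,j$, and $h\in\mathcal H$ is a unit vector. - $C_{vect}(n,m)$: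 all $p$ of the form $p(i,j|v,w)=\langle x_{v,i},y_{w,j}\rangle$, for vectors $x_{v,i},y_{w,j}$ ($v,w\in I$, $i,j\in O$) and a unit vector $h$ in a Hilbert space such that $x_{v,i}\perp x_{v,j}$ and $y_{w,i}\perp y_{w,j}$ whenever $i\ne j$; $\sum_{i}x_{v,i}=h=\sum_jy_{w,j}$ for all $v,w$; and $\langle x_{v,i},y_{w,j}\rangle\ge0$ for all $v,w,i,j$. A correlation is synchronous if $p(i,j|v,v)=0$ for all $v$ and all $i\neq j$; $C_t^s(n,m)$ denotes the set of synchronous elements of $C_t(n,m)$. For $n=3$, $m=2$ and $p\in C_t^s(3,2)$ define $$\theta(p)=\frac13\sum_{v=0}^2p(0,0|v,v),\qquad \widetilde\theta(p)=\frac16\sum_{v=0}^2\sum_{i=0}^1\big(p(i,i|v,v)+p(i,i+1|v,v+1)\big),$$ with $v+1$ taken modulo $3$ and $i+1$ modulo $2$. (Here $\widetilde\theta(p)$ is the value of the correlation $p$ for the "$\Delta$ game".) *)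

theory Defs
  imports "HOL-Analysis.Analysis" "HOL-Algebra.Algebraic_Closure_Type" "HOL-Library.Numeral_Type"
begin

section \<open>Complex Hilbert spaces with explicit carrier\<close>

text \<open>
  A Hilbert space is a module in the sense of HOL-Algebra over the field of complex numbers,
  with an inner product that is linear in the first argument.  The carrier is a subset of an
  arbitrary type \<open>'u\<close>, so that one can quantify over Hilbert spaces inside a definition;
  \<open>'u\<close> plays the role of a universe.  HOL-Algebra module records extend ring records; the
  multiplicative fields of the record are not constrained and never used.
\<close>

record 'u hilb = "(complex, 'u) module" +
  ip :: "'u \<Rightarrow> 'u \<Rightarrow> complex"

definition hnorm :: "'u hilb \<Rightarrow> 'u \<Rightarrow> real" where
  "hnorm H x = sqrt (Re (ip H x x))"

locale complex_hilbert_space =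
  module "ring_of_type_algebra :: complex ring" H for H :: "'u hilb" (structure) +
  assumes ip_add: "\<lbrakk>x \<in> carrier H; y \<in> carrier H; z \<in> carrier H\<rbrakk>
      \<Longrightarrow> ip H (x \<oplus> y) z = ip H x z + ip H y z"
    and ip_smult: "\<lbrakk>x \<in> carrier H; y \<in> carrier H\<rbrakk> \<Longrightarrow> ip H (c \<odot> x) y = c * ip H x y"
    and ip_cnj: "\<lbrakk>x \<in> carrier H; y \<in> carrier H\<rbrakk> \<Longrightarrow> ip H y x = cnj (ip H x y)"
    and ip_nonneg: "x \<in> carrier H \<Longrightarrow> 0 \<le> Re (ip H x x)"
    and ip_definite: "\<lbrakk>x \<in> carrier H; ip H x x = 0\<rbrakk> \<Longrightarrow> x = \<zero>"
    and complete: "\<lbrakk>range s \<subseteq> carrier H;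
        \<forall>e>0. \<exists>N. \<forall>k\<ge>N. \<forall>l\<ge>N. hnorm H (s k \<ominus> s l) < e\<rbrakk>
      \<Longrightarrow> \<exists>x\<in>carrier H. (\<lambda>k. hnorm H (s k \<ominus> x)) \<longlonglongrightarrow> 0"

definition finite_dimensional :: "'u hilb \<Rightarrow> bool" where
  "finite_dimensional H \<longleftrightarrow>
    (\<exists>B. finite B \<and> B \<subseteq> carrier H \<and>
      (\<forall>x\<in>carrier H. \<exists>c. x = (\<Oplus>\<^bsub>H\<^esub>b\<in>B. c b \<odot>\<^bsub>H\<^esub> b)))"

definition unit_vector :: "'u hilb \<Rightarrow> 'u \<Rightarrow> bool" where
  "unit_vector H h \<longleftrightarrow> h \<in> carrier H \<and> hnorm H h = 1"

definition linear_op :: "'u hilb \<Rightarrow> ('u \<Rightarrow> 'u) \<Rightarrow> bool" where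
  "linear_op H T \<longleftrightarrow>
    T \<in> carrier H \<rightarrow> carrier H \<and>
    (\<forall>x\<in>carrier H. \<forall>y\<in>carrier H. T (x \<oplus>\<^bsub>H\<^esub> y) = T x \<oplus>\<^bsub>H\<^esub> T y) \<and>
    (\<forall>c. \<forall>x\<in>carrier H. T (c \<odot>\<^bsub>H\<^esub> x) = c \<odot>\<^bsub>H\<^esub> T x)"

text \<open>
  An everywhere defined idempotent symmetric operator satisfies
  \<open>\<parallel>T x\<parallel>\<^sup>2 = \<langle>T x, x\<rangle>\<close> and is therefore automatically bounded by 1.
\<close>

definition projection :: "'u hilb \<Rightarrow> ('u \<Rightarrow> 'u) \<Rightarrow> bool" where
  "projection H T \<longleftrightarrow>
    linear_op H T \<and>
    (\<forall>x\<in>carrier H. T (T x) = T x) \<and>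
    (\<forall>x\<in>carrier H. \<forall>y\<in>carrier H. ip H (T x) y = ip H x (T y))"

definition pvm :: "'u hilb \<Rightarrow> ('o::finite \<Rightarrow> 'u \<Rightarrow> 'u) \<Rightarrow> bool" where
  "pvm H P \<longleftrightarrow>
    (\<forall>i. projection H (P i)) \<and>
    (\<forall>x\<in>carrier H. (\<Oplus>\<^bsub>H\<^esub>i\<in>UNIV. P i x) = x)"

text \<open>
  \<open>K\<close> together with \<open>\<tau>\<close> (that is, \<open>\<tau> a b = a \<otimes> b\<close>) is a Hilbert space tensor product of
  \<open>HA\<close> and \<open>HB\<close>.  It is unique up to unitary equivalence.  Elementary tensors are required to
  span \<open>K\<close> algebraically, with no closure, so the notion is meant for finite dimensional factors.
\<close>

definition tensor_product :: "'u hilb \<Rightarrow> 'u hilb \<Rightarrow> 'u hilb \<Rightarrow> ('u \<Rightarrow> 'u \<Rightarrow> 'u) \<Rightarrow> bool" where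
  "tensor_product HA HB K \<tau> \<longleftrightarrow>
    complex_hilbert_space K \<and>
    (\<forall>a\<in>carrier HA. \<forall>b\<in>carrier HB. \<tau> a b \<in> carrier K) \<and>
    (\<forall>a\<in>carrier HA. \<forall>a'\<in>carrier HA. \<forall>b\<in>carrier HB.
      \<tau> (a \<oplus>\<^bsub>HA\<^esub> a') b = \<tau> a b \<oplus>\<^bsub>K\<^esub> \<tau> a' b) \<and>
    (\<forall>a\<in>carrier HA. \<forall>b\<in>carrier HB. \<forall>b'\<in>carrier HB.
      \<tau> a (b \<oplus>\<^bsub>HB\<^esub> b') = \<tau> a b \<oplus>\<^bsub>K\<^esub> \<tau> a b') \<and>
    (\<forall>c. \<forall>a\<in>carrier HA. \<forall>b\<in>carrier HB.
      \<tau> (c \<odot>\<^bsub>HA\<^esub> a) b = c \<odot>\<^bsub>K\<^esub> \<tau> a b \<and> \<tau> a (c \<odot>\<^bsub>HB\<^esub> b) = c \<odot>\<^bsub>K\<^esub> \<tau> a b) \<and>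
    (\<forall>a\<in>carrier HA. \<forall>a'\<in>carrier HA. \<forall>b\<in>carrier HB. \<forall>b'\<in>carrier HB.
      ip K (\<tau> a b) (\<tau> a' b') = ip HA a a' * ip HB b b') \<and>
    (\<forall>z\<in>carrier K. \<exists>(r::nat) a b.
      (\<forall>k<r. a k \<in> carrier HA \<and> b k \<in> carrier HB) \<and>
      z = (\<Oplus>\<^bsub>K\<^esub>k\<in>{..<r}. \<tau> (a k) (b k)))"

text \<open>\<open>R\<close> is the operator \<open>S \<otimes> T\<close> on \<open>K\<close>; these conditions determine it on \<open>carrier K\<close>.\<close>

definition is_tensor_op ::
    "'u hilb \<Rightarrow> 'u hilb \<Rightarrow> 'u hilb \<Rightarrow> ('u \<Rightarrow> 'u \<Rightarrow> 'u) \<Rightarrow>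
      ('u \<Rightarrow> 'u) \<Rightarrow> ('u \<Rightarrow> 'u) \<Rightarrow> ('u \<Rightarrow> 'u) \<Rightarrow> bool" where
  "is_tensor_op HA HB K \<tau> S T R \<longleftrightarrow>
    linear_op K R \<and> (\<forall>a\<in>carrier HA. \<forall>b\<in>carrier HB. R (\<tau> a b) = \<tau> (S a) (T b))"


section \<open>Correlations\<close>

text \<open>
  The inputs and the outputs are the elements of finite types \<open>'i\<close> and \<open>'o\<close>;
  \<open>p $ (i, j, v, w)\<close> stands for \<open>p(i,j|v,w)\<close>.  For \<open>n\<close> inputs and \<open>m\<close> outputs, use the numeral
  types of these cardinalities, whose arithmetic is modulo \<open>n\<close> and modulo \<open>m\<close>.
\<close>

type_synonym ('i, 'o) corr = "real ^ ('o \<times> 'o \<times> 'i \<times> 'i)"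

definition correlation :: "('i::finite, 'o::finite) corr \<Rightarrow> bool" where
  "correlation p \<longleftrightarrow>
    (\<forall>i j v w. 0 \<le> p $ (i, j, v, w)) \<and>
    (\<forall>v w. (\<Sum>i\<in>UNIV. \<Sum>j\<in>UNIV. p $ (i, j, v, w)) = 1)"

definition C_q :: "'u itself \<Rightarrow> ('i::finite, 'o::finite) corr set" where
  "C_q U = {p. correlation p \<and>
    (\<exists>(HA :: 'u hilb) (HB :: 'u hilb) (K :: 'u hilb) \<tau> P Q h.
      complex_hilbert_space HA \<and> finite_dimensional HA \<and>
      complex_hilbert_space HB \<and> finite_dimensional HB \<and>
      tensor_product HA HB K \<tau> \<and>
      (\<forall>v. pvm HA (P v)) \<and> (\<forall>w. pvm HB (Q w)) \<and>
      unit_vector K h \<and>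
      (\<forall>i j v w. \<exists>R. is_tensor_op HA HB K \<tau> (P v i) (Q w j) R \<and>
        complex_of_real (p $ (i, j, v, w)) = ip K (R h) h))}"

definition C_qa :: "'u itself \<Rightarrow> ('i::finite, 'o::finite) corr set" where
  "C_qa U = closure (C_q U)"

definition C_qc :: "'u itself \<Rightarrow> ('i::finite, 'o::finite) corr set" where
  "C_qc U = {p. correlation p \<and>
    (\<exists>(H :: 'u hilb) P Q h.
      complex_hilbert_space H \<and>
      (\<forall>v. pvm H (P v)) \<and> (\<forall>w. pvm H (Q w)) \<and>
      (\<forall>v w i j. \<forall>x\<in>carrier H. P v i (Q w j x) = Q w j (P v i x)) \<and>
      unit_vector H h \<and>
      (\<forall>i j v w. complex_of_real (p $ (i, j, v, w)) = ip H (P v i (Q w j h)) h))}"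

definition C_vect :: "'u itself \<Rightarrow> ('i::finite, 'o::finite) corr set" where
  "C_vect U = {p. correlation p \<and>
    (\<exists>(H :: 'u hilb) x y h.
      complex_hilbert_space H \<and>
      (\<forall>v i. x v i \<in> carrier H) \<and> (\<forall>w j. y w j \<in> carrier H) \<and>
      unit_vector H h \<and>
      (\<forall>v i j. i \<noteq> j \<longrightarrow> ip H (x v i) (x v j) = 0) \<and>
      (\<forall>w i j. i \<noteq> j \<longrightarrow> ip H (y w i) (y w j) = 0) \<and>
      (\<forall>v. (\<Oplus>\<^bsub>H\<^esub>i\<in>UNIV. x v i) = h) \<and>
      (\<forall>w. (\<Oplus>\<^bsub>H\<^esub>j\<in>UNIV. y w j) = h) \<and>
      (\<forall>i j v w. 0 \<le> p $ (i, j, v, w) \<and>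
        complex_of_real (p $ (i, j, v, w)) = ip H (x v i) (y w j)))}"

datatype corr_type = tq | tqa | tqc | tvect

fun C_of_type :: "'u itself \<Rightarrow> corr_type \<Rightarrow> ('i::finite, 'o::finite) corr set" where
  "C_of_type U tq = C_q U"
| "C_of_type U tqa = C_qa U"
| "C_of_type U tqc = C_qc U"
| "C_of_type U tvect = C_vect U"

definition synchronous :: "('i::finite, 'o::finite) corr \<Rightarrow> bool" where
  "synchronous p \<longleftrightarrow> (\<forall>v i j. i \<noteq> j \<longrightarrow> p $ (i, j, v, v) = 0)"

definition C_sync :: "'u itself \<Rightarrow> corr_type \<Rightarrow> ('i::finite, 'o::finite) corr set" where
  "C_sync U t = {p \<in> C_of_type U t. synchronous p}"


section \<open>The synchronous value of the Delta game\<close>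

definition theta :: "(3, 2) corr \<Rightarrow> real" where
  "theta p = 1 / 3 * (\<Sum>v\<in>UNIV. p $ (0, 0, v, v))"

text \<open>Here \<open>v + 1\<close> is addition in type \<open>3\<close> and \<open>i + 1\<close> addition in type \<open>2\<close>, hence modular.\<close>

definition theta_tilde :: "(3, 2) corr \<Rightarrow> real" where
  "theta_tilde p =
    1 / 6 * (\<Sum>v\<in>UNIV. \<Sum>i\<in>UNIV. p $ (i, i, v, v) + p $ (i, i + 1, v, v + 1))"

definition Theta :: "'u itself \<Rightarrow> corr_type \<Rightarrow> (real \<times> real) set" where
  "Theta U t = (\<lambda>p. (theta p, theta_tilde p)) ` C_sync U t"

text \<open>
  Suprema and infima are those of the type of reals, hence only meaningful for
  nonempty bounded sets.
\<close>

definition f_upper :: "'u itself \<Rightarrow> corr_type \<Rightarrow> real \<Rightarrow> real" where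
  "f_upper U t \<theta> = Sup {s. (\<theta>, s) \<in> Theta U t}"

definition f_lower :: "'u itself \<Rightarrow> corr_type \<Rightarrow> real \<Rightarrow> real" where
  "f_lower U t \<theta> = Inf {s. (\<theta>, s) \<in> Theta U t}"

end

(* With a(v,w) = p(0,0|v,w), synchronicity and no-signalling give
   theta_tilde = 1/2 + theta - (a(0,1) + a(1,2) + a(2,0)) / 3, and nonnegativity of p gives the outer
   pieces of the upper bounds.  In the vector case the middle piece is
   0 <= |x_0 + x_1 + x_2 - 3 theta h|^2.  In the commuting case a(v,w) = tau(p_v p_w) for a tracial
   state tau, and the middle pieces amount to
     tau(p_0 p_1 + p_1 p_2 + p_2 p_0) >= 3/4 (tau(p_0 + p_1 + p_2) - 1)
   for the p_v and for their complements, which is certified by a sum of hermitian squares modulo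
   cyclic permutation of words.  For C_qa the approximating correlations are not synchronous, hence
   not tracial; but their word moments are bounded and tracial up to an error that vanishes in the
   limit, so a pointwise limit of moment functionals is exactly tracial. *)
theory Submission
  imports Defs
begin

section \<open>Tracial functionals on words in three projections\<close>

text \<open>The commuting region turns out to be the convex hull of five points: (0, 1/2), (1, 1/2),
  (1/3, 5/6), (2/3, 5/6) from deterministic strategies and (1/2, 7/8) from three lines in the plane.
  The middle pieces are the edges meeting at (1/2, 7/8), so the trace inequality must be sharp both
  for a commutative model and for the lines. This fixes the constant 3/4 and restricts the
  polynomials that may be squared. Exchanging the outcomes replaces theta by 1 - theta and fixes
  theta_tilde, so one inequality yields both edges. The parabola of the vector case passes through
  the same five points and is strictly concave, whence the strict inclusion. A trace occurs only as
  a real function on words; no operator algebra is built from it, and the limit for C_qa becomes a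
  compactness argument in a product of intervals.\<close>

definition tracial :: "('a list \<Rightarrow> real) \<Rightarrow> bool" where
  "tracial m \<longleftrightarrow> m [] = 1 \<and> (\<forall>u x v. m (u @ x # x # v) = m (u @ x # v)) \<and>
    (\<forall>w. m (rev w) = m w) \<and> (\<forall>x w. m (x # w) = m (w @ [x])) \<and>
    (\<forall>L. 0 \<le> (\<Sum>(a, u)\<leftarrow>L. \<Sum>(b, w)\<leftarrow>L. a * b * m (rev u @ w)))"

text \<open>One removal at the ends suffices: after \<open>remdups_adj\<close> neighbours differ, so
  once the first letter is dropped the new first letter differs from the last.\<close>

definition cyc_reduce :: "'a list \<Rightarrow> 'a list" where
  "cyc_reduce w = (let u = remdups_adj w in
     case u of x # y # v \<Rightarrow> if last (y # v) = x then y # v else u | _ \<Rightarrow> u)"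

text \<open>The first argument is a counter whose length bounds the number of rotations, so the
  recursion is structural and easy to evaluate.\<close>

fun rots :: "nat list \<Rightarrow> 'a list \<Rightarrow> 'a list list" where
  "rots [] w = [w]"
| "rots (_ # k) w = w # rots k (rotate1 w)"

fun lex_le :: "nat list \<Rightarrow> nat list \<Rightarrow> bool" where
  "lex_le [] _ = True"
| "lex_le (x # u) [] = False"
| "lex_le (x # u) (y # v) = (if x = y then lex_le u v else x < y)"

text \<open>Reversals are included because a word and its adjoint have the same real moment.
  Soundness comes from the fold returning one of its candidates; minimality makes equivalent words
  coincide in the computation.\<close>

definition necklace :: "nat list \<Rightarrow> nat list" where
  "necklace w = (let u = cyc_reduce w in
     fold (\<lambda>a b. if lex_le a b then a else b) (rots u u @ rots u (rev u)) u)"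

lemma tracial_remdups_adj:
  assumes "tracial m" shows "m (u @ remdups_adj w) = m (u @ w)"
proof (induction w arbitrary: u rule: remdups_adj.induct)
  case (3 x y xs)
  show ?case
  proof (cases "x = y")
    case True
    then show ?thesis using 3(1)[of u] assms by (simp add: tracial_def)
  next
    case False
    then show ?thesis using 3(2)[of "u @ [x]"] by simp
  qed
qed auto

lemma tracial_append: "tracial m \<Longrightarrow> m (u @ v) = m (v @ u)"
proof (induction u arbitrary: v)
  case (Cons x u)
  have "m ((x # u) @ v) = m (u @ (v @ [x]))" using Cons.prems by (simp add: tracial_def)
  also have "\<dots> = m ((v @ [x]) @ u)" using Cons by blast
  finally show ?case by simp
qed simp

lemma tracial_cyc_reduce:
  assumes m: "tracial m" shows "m (cyc_reduce w) = m w"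
proof -
  \<comment> \<open>By cyclicity x z x becomes z x x, where the doubled letter collapses.\<close>
  have *: "m (x # y # v) = m (y # v)" if "last (y # v) = x" for x y v
  proof -
    have "y # v = butlast (y # v) @ [x]" using that by (metis append_butlast_last_id list.distinct(1))
    then obtain z where z: "y # v = z @ [x]" by blast
    have "m (x # z @ [x]) = m (z @ x # x # [])" using m by (simp add: tracial_def)
    also have "\<dots> = m (z @ [x])" using m unfolding tracial_def by blast
    finally show ?thesis using z by simp
  qed
  have "m (remdups_adj w) = m w" using tracial_remdups_adj[OF m, of "[]" w] by simp
  then show ?thesis
    using * by (simp add: cyc_reduce_def Let_def split: list.split del: last.simps) metis
qed

lemma tracial_rots:
  assumes "tracial m" shows "w' \<in> set (rots k w) \<Longrightarrow> m w' = m w"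
proof (induction k w rule: rots.induct)
  case (2 a k w)
  have "m (rotate1 w) = m w" using assms by (cases w) (auto simp: tracial_def)
  then show ?case using 2 by auto
qed auto

lemma tracial_necklace:
  assumes m: "tracial m" shows "m (necklace w) = m w"
proof -
  have *: "(\<And>a. a \<in> set L \<Longrightarrow> m a = c) \<Longrightarrow> m b = c \<Longrightarrow> m (fold (\<lambda>a b. if lex_le a b then a else b) L b) = c" for L b c
    by (induction L arbitrary: b) auto
  have "m (rev w) = m w" for w using m by (simp add: tracial_def)
  then show ?thesis
    unfolding necklace_def Let_def
    by (subst tracial_cyc_reduce[OF m, symmetric], intro *) (auto simp: tracial_rots[OF m])
qed

text \<open>
  A list of pairs \<open>(a, w)\<close> stands for the noncommutative polynomial \<open>\<Sum> a w\<close> in the projections.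
  Choosing a common representative of all rotations and reflections of a word turns identities
  modulo the trace property into syntactic ones.
\<close>

definition eval_words :: "(nat list \<Rightarrow> real) \<Rightarrow> (int \<times> nat list) list \<Rightarrow> real" where
  "eval_words m L = (\<Sum>(a, w)\<leftarrow>L. real_of_int a * m w)"

fun add_term :: "int \<Rightarrow> nat list \<Rightarrow> (int \<times> nat list) list \<Rightarrow> (int \<times> nat list) list" where
  "add_term a w [] = [(a, w)]"
| "add_term a w ((b, v) # L) = (if w = v then (a + b, v) # L else (b, v) # add_term a w L)"

text \<open>A pair \<open>(c, L)\<close> stands for c times the hermitian square of L; reversing a
  word gives its adjoint because the letters are self-adjoint. Integer coefficients keep the
  expansion exact.\<close>

fun add_squares :: "(int \<times> (int \<times> nat list) list) list \<Rightarrow> (int \<times> nat list) list" where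
  "add_squares [] = []"
| "add_squares ((c, L) # Ls) = fold (\<lambda>(a, u). fold (\<lambda>(b, w).
     add_term (c * a * b) (necklace (rev u @ w))) L) L (add_squares Ls)"

lemma eval_words_add_term: "eval_words m (add_term a w L) = a * m w + eval_words m L"
  by (induction a w L rule: add_term.induct) (auto simp: eval_words_def algebra_simps)

lemma eval_words_add_squares_nonneg:
  assumes m: "tracial m" and "\<forall>(c, L)\<in>set Ls. 0 \<le> c"
  shows "0 \<le> eval_words m (add_squares Ls)"
  using assms(2)
proof (induction Ls rule: add_squares.induct)
  case (2 c L Ls)
  have inner: "eval_words m (fold (\<lambda>(b, w). add_term (c * a * b) (necklace (rev u @ w))) L' M) =
      real_of_int c * (\<Sum>(b, w)\<leftarrow>L'. real_of_int a * real_of_int b * m (rev u @ w)) + eval_words m M" for a u L' M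
    by (induction L' arbitrary: M)
      (auto simp: eval_words_add_term tracial_necklace[OF m] algebra_simps)
  have outer: "eval_words m (fold (\<lambda>(a, u). fold (\<lambda>(b, w).
        add_term (c * a * b) (necklace (rev u @ w))) L) L' M) =
      real_of_int c * (\<Sum>(a, u)\<leftarrow>L'. \<Sum>(b, w)\<leftarrow>L. real_of_int a * real_of_int b * m (rev u @ w)) +
        eval_words m M" for L' M
    by (induction L' arbitrary: M) (auto simp: inner distrib_left)
  let ?L = "map (\<lambda>(a, u). (real_of_int a, u)) L"
  have "0 \<le> (\<Sum>(a, u)\<leftarrow>?L. \<Sum>(b, w)\<leftarrow>?L. a * b * m (rev u @ w))"
    using m unfolding tracial_def by blast
  then have "0 \<le> (\<Sum>(a, u)\<leftarrow>L. \<Sum>(b, w)\<leftarrow>L. real_of_int a * real_of_int b * m (rev u @ w))"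
    by (simp add: comp_def case_prod_unfold)
  then show ?case using 2 by (simp add: outer)
qed (simp add: eval_words_def)

text \<open>
  With \<open>S = p\<^sub>0 + p\<^sub>1 + p\<^sub>2\<close>, the list \<open>chain 1 x z y\<close> is \<open>2 p\<^sub>x (S - 3/2) p\<^sub>y\<close> for distinct \<open>x, y, z\<close>,
  and \<open>quadratic\<close> is \<open>18 (S - 1) (S - 3/2)\<close>.  Equality holds for three orthogonal projections of
  sum 1 and for three planar lines at angle \<open>\<pi> / 3\<close> (where \<open>S = 3/2\<close>), so only polynomials
  that vanish in both cases can be squared; besides these two families, the differences of the
  commutators \<open>[p\<^sub>0, p\<^sub>1]\<close>, \<open>[p\<^sub>1, p\<^sub>2]\<close>, \<open>[p\<^sub>2, p\<^sub>0]\<close> do.  The weights come from solving the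
  semidefinite program, after symmetrisation over the permutations of the three projections.
\<close>

definition chain :: "int \<Rightarrow> nat \<Rightarrow> nat \<Rightarrow> nat \<Rightarrow> (int \<times> nat list) list" where
  "chain a x z y = [(2 * a, [x, z, y]), (a, [x, y])]"

definition sym_chain :: "int \<Rightarrow> nat \<Rightarrow> nat \<Rightarrow> nat \<Rightarrow> (int \<times> nat list) list" where
  "sym_chain a x y z = chain a x z y @ chain a y z x"

definition skew_chain :: "int \<Rightarrow> nat \<Rightarrow> nat \<Rightarrow> nat \<Rightarrow> (int \<times> nat list) list" where
  "skew_chain a x y z = chain a x z y @ chain (- a) y z x"

definition commutator :: "int \<Rightarrow> nat \<Rightarrow> nat \<Rightarrow> (int \<times> nat list) list" where
  "commutator a x y = [(a, [x, y]), (- a, [y, x])]"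

definition quadratic :: "(int \<times> nat list) list" where
  "quadratic = [(27, []), (-27, [0]), (-27, [1]), (-27, [2]),
    (18, [0, 1]), (18, [1, 0]), (18, [1, 2]), (18, [2, 1]), (18, [2, 0]), (18, [0, 2])]"

text \<open>The first five polynomials are hermitian and the others antihermitian; the trace of a
  product of one of each kind vanishes. Under permutations of the projections the first two rows are
  invariant, the row of weight 63 changes by the sign, and each triple of cyclic differences gives
  an invariant form on a two-dimensional representation.\<close>

definition certificate :: "(int \<times> (int \<times> nat list) list) list" where
  "certificate =
    [(2, quadratic @ sym_chain (-1) 0 1 2 @ sym_chain (-1) 1 2 0 @ sym_chain (-1) 2 0 1),
     (1, sym_chain 1 0 1 2 @ sym_chain 1 1 2 0 @ sym_chain 1 2 0 1),
     (48, sym_chain 1 0 1 2 @ sym_chain (-1) 1 2 0),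
     (48, sym_chain 1 1 2 0 @ sym_chain (-1) 2 0 1),
     (48, sym_chain 1 2 0 1 @ sym_chain (-1) 0 1 2),
     (63, skew_chain 1 0 1 2 @ skew_chain 1 1 2 0 @ skew_chain 1 2 0 1),
     (12, commutator 6 0 1 @ commutator (-6) 1 2 @ skew_chain (-1) 0 1 2 @ skew_chain 1 1 2 0),
     (12, commutator 6 1 2 @ commutator (-6) 2 0 @ skew_chain (-1) 1 2 0 @ skew_chain 1 2 0 1),
     (12, commutator 6 2 0 @ commutator (-6) 0 1 @ skew_chain (-1) 2 0 1 @ skew_chain 1 0 1 2),
     (6, skew_chain 1 0 1 2 @ skew_chain (-1) 1 2 0),
     (6, skew_chain 1 1 2 0 @ skew_chain (-1) 2 0 1),
     (6, skew_chain 1 2 0 1 @ skew_chain (-1) 0 1 2)]"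

lemma eval_words_filter: "eval_words m (filter (\<lambda>(a, w). a \<noteq> 0) L) = eval_words m L"
  by (induction L) (auto simp: eval_words_def)

lemma add_squares_certificate:
  "filter (\<lambda>(a, w). a \<noteq> 0) (add_squares certificate) =
    [(1944, [0, 2]), (1944, [0, 1]), (1944, [1, 2]), (1458, []),
     (-1458, [0]), (-1458, [1]), (-1458, [2])]"
  by code_simp

lemma tracial_sum_bound:
  assumes m: "tracial (m :: nat list \<Rightarrow> real)"
  shows "3 / 4 * (m [0] + m [1] + m [2] - 1) \<le> m [0, 1] + m [1, 2] + m [2, 0]"
proof -
  \<comment> \<open>The certificate is 1944 times the claim, as 1458 = 1944 * 3/4; all words of
    length three or more have cancelled.\<close>
  have "0 \<le> eval_words m (filter (\<lambda>(a, w). a \<noteq> 0) (add_squares certificate))"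
    unfolding eval_words_filter by (rule eval_words_add_squares_nonneg[OF m]) (simp add: certificate_def)
  moreover have "m [] = 1" using m unfolding tracial_def by blast
  moreover have "m [2, 0] = m [0, 2]" using tracial_append[OF m, of "[2]" "[0]"] by simp
  ultimately show ?thesis
    unfolding add_squares_certificate by (simp add: eval_words_def)
qed


section \<open>Moments of commuting correlations\<close>

lemma carrier_complex_ring [simp]: "carrier (ring_of_type_algebra :: complex ring) = UNIV"
  by (simp add: ring_of_type_algebra_def)

context complex_hilbert_space
begin

lemma smult_closed' [simp, intro]: "x \<in> carrier H \<Longrightarrow> c \<odot> x \<in> carrier H"
  by (rule smult_closed) auto

lemma ip_add_right:
  "\<lbrakk>x \<in> carrier H; y \<in> carrier H; z \<in> carrier H\<rbrakk> \<Longrightarrow> ip H x (y \<oplus> z) = ip H x y + ip H x z"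
  by (metis M.a_closed complex_cnj_add ip_add ip_cnj)

lemma ip_zero_left [simp]: "x \<in> carrier H \<Longrightarrow> ip H \<zero> x = 0"
  by (metis M.zero_closed M.l_zero add_cancel_right_left ip_add)

lemma ip_zero_right [simp]: "x \<in> carrier H \<Longrightarrow> ip H x \<zero> = 0"
  by (metis M.zero_closed complex_cnj_zero ip_cnj ip_zero_left)

lemma Re_ip_commute: "\<lbrakk>x \<in> carrier H; y \<in> carrier H\<rbrakk> \<Longrightarrow> Re (ip H x y) = Re (ip H y x)"
  using ip_cnj[of x y] by simp

lemma ip_finsum_left:
  "\<lbrakk>finite A; f \<in> A \<rightarrow> carrier H; y \<in> carrier H\<rbrakk> \<Longrightarrow>
    ip H (\<Oplus>i\<in>A. f i) y = (\<Sum>i\<in>A. ip H (f i) y)"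
  by (induction A rule: finite_induct) (auto simp: Pi_iff ip_add)

text \<open>The double sum is the squared norm of a real linear combination of the listed vectors.
  Stated for lists to match the positivity condition on word functionals.\<close>

lemma gram_nonneg:
  assumes "\<forall>(a, x)\<in>set L. x \<in> carrier H"
  shows "0 \<le> (\<Sum>(a, x)\<leftarrow>L. \<Sum>(b, y)\<leftarrow>L. a * b * Re (ip H x y))"
proof -
  define z where "z L = foldr (\<lambda>(a, x) z. complex_of_real a \<odot> x \<oplus> z) L \<zero>" for L
  have z: "z L \<in> carrier H" if "\<forall>(a, x)\<in>set L. x \<in> carrier H" for L
    using that by (induction L) (auto simp: z_def)
  have l: "Re (ip H (z L) y) = (\<Sum>(a, x)\<leftarrow>L. a * Re (ip H x y))"
    if "\<forall>(a, x)\<in>set L. x \<in> carrier H" "y \<in> carrier H" for L y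
    using that
  proof (induction L)
    case (Cons ax L)
    then show ?case using z[of L]
      by (cases ax) (auto simp: z_def ip_add ip_smult)
  qed (simp add: z_def)
  have r: "Re (ip H x (z L)) = (\<Sum>(b, y)\<leftarrow>L. b * Re (ip H x y))"
    if "\<forall>(a, x)\<in>set L. x \<in> carrier H" "x \<in> carrier H" for L x
  proof -
    have "map (\<lambda>(a, y). a * Re (ip H y x)) L = map (\<lambda>(b, y). b * Re (ip H x y)) L"
      using that by (intro map_cong) (auto simp: Re_ip_commute[of x])
    then have "(\<Sum>(a, y)\<leftarrow>L. a * Re (ip H y x)) = (\<Sum>(b, y)\<leftarrow>L. b * Re (ip H x y))"
      by (rule arg_cong)
    then show ?thesis
      using that z[of L] l[of L x] Re_ip_commute[of x "z L"] by simp
  qed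
  have "Re (ip H (z L) (z L)) = (\<Sum>(a, x)\<leftarrow>L. a * Re (ip H x (z L)))"
    using l z assms by blast
  also have "\<dots> = (\<Sum>(a, x)\<leftarrow>L. a * (\<Sum>(b, y)\<leftarrow>L. b * Re (ip H x y)))"
  proof (rule arg_cong[where f=sum_list], rule map_cong[OF refl])
    fix ax assume "ax \<in> set L"
    then obtain a x where "ax = (a, x)" "x \<in> carrier H" using assms by (cases ax) auto
    then show "(case ax of (a, x) \<Rightarrow> a * Re (ip H x (z L))) =
        (case ax of (a, x) \<Rightarrow> a * (\<Sum>(b, y)\<leftarrow>L. b * Re (ip H x y)))"
      using r[OF assms] by simp
  qed
  also have "\<dots> = (\<Sum>(a, x)\<leftarrow>L. \<Sum>(b, y)\<leftarrow>L. a * b * Re (ip H x y))"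
    by (intro arg_cong[where f=sum_list] map_cong)
      (auto simp flip: sum_list_const_mult simp: case_prod_unfold mult.assoc)
  finally show ?thesis using ip_nonneg[OF z[OF assms]] by simp
qed

text \<open>Cauchy-Schwarz for x against y - z. The right side is the squared norm of y - z written
  out, the form in which correlations deliver it.\<close>

lemma Re_ip_diff_le:
  assumes "x \<in> carrier H" "y \<in> carrier H" "z \<in> carrier H" "Re (ip H x x) \<le> 1"
  shows "(Re (ip H x y) - Re (ip H x z))\<^sup>2 \<le>
    Re (ip H y y) + Re (ip H z z) - 2 * Re (ip H y z)"
proof -
  define r where "r = Re (ip H x y) - Re (ip H x z)"
  have "r\<^sup>2 * Re (ip H x x) \<le> r\<^sup>2"
    using assms(4) by (simp add: mult_left_le)
  \<comment> \<open>Squared norm of y - z - r x, with r the very quantity to be bounded.\<close>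
  moreover have "0 \<le> r\<^sup>2 * Re (ip H x x) - 2 * r * (Re (ip H x y) - Re (ip H x z)) +
      (Re (ip H y y) + Re (ip H z z) - 2 * Re (ip H y z))"
    using gram_nonneg[of "[(- r, x), (1, y), (- 1, z)]"] assms
      Re_ip_commute[of x y] Re_ip_commute[of x z] Re_ip_commute[of y z]
    by (simp add: algebra_simps power2_eq_square)
  moreover have "2 * r * (Re (ip H x y) - Re (ip H x z)) = 2 * r\<^sup>2"
    by (simp add: r_def power2_eq_square)
  ultimately show ?thesis unfolding r_def[symmetric] by linarith
qed

lemma projection_closed: "projection H T \<Longrightarrow> x \<in> carrier H \<Longrightarrow> T x \<in> carrier H"
  by (auto simp: projection_def linear_op_def)

lemma projection_idem: "projection H T \<Longrightarrow> x \<in> carrier H \<Longrightarrow> T (T x) = T x"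
  by (auto simp: projection_def)

lemma projection_sym:
  "projection H T \<Longrightarrow> x \<in> carrier H \<Longrightarrow> y \<in> carrier H \<Longrightarrow> ip H (T x) y = ip H x (T y)"
  by (auto simp: projection_def)

lemma projection_contract:
  assumes T: "projection H T" and x: "x \<in> carrier H"
  shows "Re (ip H (T x) (T x)) \<le> Re (ip H x x)"
proof -
  have "ip H (T x) (T x) = ip H x (T x)" "ip H (T x) x = ip H x (T x)"
    using projection_sym[OF T] projection_idem[OF T] projection_closed[OF T] x by metis+
  \<comment> \<open>The squared norm of x - T x equals |x|^2 - |T x|^2.\<close>
  then show ?thesis
    using gram_nonneg[of "[(1, x), (- 1, T x)]"] x projection_closed[OF T x] by simp
qed

end

section \<open>Words of projections as operators\<close>

definition word_op :: "('v \<Rightarrow> 'u \<Rightarrow> 'u) \<Rightarrow> 'v list \<Rightarrow> 'u \<Rightarrow> 'u" where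
  "word_op P w x = foldr P w x"

lemma word_op_simps [simp]:
  "word_op P [] x = x" "word_op P (v # w) x = P v (word_op P w x)"
  "word_op P (u @ w) x = word_op P u (word_op P w x)"
  by (simp_all add: word_op_def)

context complex_hilbert_space
begin

context
  fixes P :: "'v \<Rightarrow> 'u \<Rightarrow> 'u"
  assumes P: "\<And>v. projection H (P v)"
begin

lemma word_op_closed: "x \<in> carrier H \<Longrightarrow> word_op P w x \<in> carrier H"
  by (induction w) (auto intro: projection_closed P)

lemma word_op_sym:
  "x \<in> carrier H \<Longrightarrow> y \<in> carrier H \<Longrightarrow> ip H (word_op P w x) y = ip H x (word_op P (rev w) y)"
  by (induction w arbitrary: y)
    (simp_all add: projection_sym[OF P] word_op_closed projection_closed[OF P])

lemma word_op_contract: "x \<in> carrier H \<Longrightarrow> Re (ip H (word_op P w x) (word_op P w x)) \<le> Re (ip H x x)"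
proof (induction w)
  case (Cons v w)
  then show ?case
    using projection_contract[OF P word_op_closed, of x v w] by simp
qed simp

lemma word_op_commute:
  assumes "\<And>v x. x \<in> carrier H \<Longrightarrow> T (P v x) = P v (T x)" "x \<in> carrier H"
  shows "T (word_op P w x) = word_op P w (T x)"
  using assms(2) by (induction w) (auto simp: assms(1) word_op_closed)

end
end

text \<open>Equals the sum of the entries p(i,j|v,v) and p(j,i|v,v) with j different from i, so it
  vanishes for synchronous p and is continuous in p. In a commuting model it is the squared norm of
  P_{v,i} h - Q_{v,i} h.\<close>

definition defect :: "('i::finite, 'o::finite) corr \<Rightarrow> 'o \<Rightarrow> 'i \<Rightarrow> real" where
  "defect p i v = (\<Sum>j\<in>UNIV. p $ (i, j, v, v)) + (\<Sum>j\<in>UNIV. p $ (j, i, v, v)) - 2 * p $ (i, i, v, v)"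

text \<open>What remains of \<open>tracial\<close> in a general commuting model, where cyclicity
  holds only up to the defect.\<close>

definition positive_type :: "('a list \<Rightarrow> real) \<Rightarrow> bool" where
  "positive_type m \<longleftrightarrow> m [] = 1 \<and> (\<forall>u x v. m (u @ x # x # v) = m (u @ x # v)) \<and>
    (\<forall>w. m (rev w) = m w) \<and>
    (\<forall>L. 0 \<le> (\<Sum>(a, u)\<leftarrow>L. \<Sum>(b, w)\<leftarrow>L. a * b * m (rev u @ w)))"

text \<open>The moment of a word in the projections P_{v,i}, with the outcome i fixed, is its
  expectation in the state h. If the defect is small, P_{v,i} h is close to Q_{v,i} h, and Q_{v,i}
  commutes with all these words, so a letter can be carried from the front to the back.\<close>

lemma C_qc_moments:
  fixes p :: "('i::finite, 'o::finite) corr"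
  assumes "p \<in> C_qc (U :: 'u itself)"
  obtains m :: "'i list \<Rightarrow> real" where "positive_type m" "\<And>w. \<bar>m w\<bar> \<le> 1"
    "\<And>v w. (m (v # w) - m (w @ [v]))\<^sup>2 \<le> 4 * defect p i v"
    "\<And>v. m [v] = (\<Sum>j\<in>UNIV. p $ (i, j, v, v))"
    "\<And>v w. (m [v, w] - p $ (i, i, v, w))\<^sup>2 \<le> defect p i w"
proof -
  from assms obtain H :: "'u hilb" and P Q h where H: "complex_hilbert_space H"
    and P': "\<forall>v. pvm H (P v)" and Q': "\<forall>w. pvm H (Q w)"
    and comm': "\<forall>v w i j. \<forall>x\<in>carrier H. P v i (Q w j x) = Q w j (P v i x)"
    and h: "unit_vector H h"
    and p: "\<forall>i j v w. complex_of_real (p $ (i, j, v, w)) = ip H (P v i (Q w j h)) h"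
    unfolding C_qc_def mem_Collect_eq by (elim conjE exE)
  note PQ = P'[rule_format] Q'[rule_format] and comm = comm'[rule_format] and p = p[rule_format]
  interpret complex_hilbert_space H by fact
  note [simp] = word_op_closed projection_closed
  have P [simp]: "projection H (P v i)" and Q [simp]: "projection H (Q v i)" for v i
    using PQ by (auto simp: pvm_def)
  have h [simp]: "h \<in> carrier H" and hh: "Re (ip H h h) = 1"
    using h by (auto simp: unit_vector_def hnorm_def)
  have p': "p $ (i, j, v, w) = Re (ip H (Q w j h) (P v i h))" for i j v w
    using p[of i j v w] projection_sym[OF P, of "Q w j h" h v i] by (metis Re_complex_of_real h projection_closed Q)
  define R where "R v = P v i" for v
  have R [simp]: "projection H (R v)" for v by (simp add: R_def)
  define m where "m w = Re (ip H (word_op R w h) h)" for w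
  have m_eq: "Re (ip H (word_op R u h) (word_op R w h)) = m (rev u @ w)" for u w
  proof -
    have "Re (ip H (word_op R u h) (word_op R w h)) = Re (ip H h (word_op R (rev u @ w) h))"
      by (subst word_op_sym) simp_all
    then show ?thesis by (simp add: m_def Re_ip_commute[of h])
  qed
  have pos: "positive_type m"
    unfolding positive_type_def
  proof (intro conjI allI)
    show "m (u @ x # x # v) = m (u @ x # v)" for u x v
      by (simp add: m_def projection_idem)
    show "m (rev w) = m w" for w
      using m_eq[of w "[]"] by (simp add: m_def)
    show "0 \<le> (\<Sum>(a, u)\<leftarrow>L. \<Sum>(b, w)\<leftarrow>L. a * b * m (rev u @ w))" for L
      using gram_nonneg[of "map (\<lambda>(a, u). (a, word_op R u h)) L"]
      by (auto simp: comp_def case_prod_unfold m_eq)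
  qed (simp add: m_def hh)
  have contr: "Re (ip H (word_op R w h) (word_op R w h)) \<le> 1" for w
    using word_op_contract[of R h w] hh by simp
  have sumQ: "(\<Sum>j\<in>UNIV. p $ (i, j, v, w)) = Re (ip H (P v i h) (P v i h))" for i v w
  proof -
    have "(\<Oplus>\<^bsub>H\<^esub>j\<in>UNIV. Q w j h) = h" using PQ by (simp add: pvm_def)
    then have "ip H h (P v i h) = (\<Sum>j\<in>UNIV. ip H (Q w j h) (P v i h))"
      using ip_finsum_left[of UNIV "\<lambda>j. Q w j h" "P v i h"] by simp
    then show ?thesis
      by (simp add: p' projection_sym projection_idem)
  qed
  have sumP: "(\<Sum>i\<in>UNIV. p $ (i, j, v, w)) = Re (ip H (Q w j h) (Q w j h))" for j v w
  proof -
    have "(\<Oplus>\<^bsub>H\<^esub>i\<in>UNIV. P v i h) = h" using PQ by (simp add: pvm_def)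
    then have "ip H h (Q w j h) = (\<Sum>i\<in>UNIV. ip H (P v i h) (Q w j h))"
      using ip_finsum_left[of UNIV "\<lambda>i. P v i h" "Q w j h"] by simp
    then have "Re (ip H h (Q w j h)) = (\<Sum>i\<in>UNIV. p $ (i, j, v, w))"
      by (simp add: p' Re_ip_commute[of "Q w j h"])
    moreover have "Re (ip H h (Q w j h)) = Re (ip H (Q w j h) (Q w j h))"
      by (simp add: projection_sym projection_idem)
    ultimately show ?thesis by simp
  qed
  have defect: "defect p i v =
      Re (ip H (R v h) (R v h)) + Re (ip H (Q v i h) (Q v i h)) - 2 * Re (ip H (R v h) (Q v i h))" for v
    unfolding defect_def sumP sumQ by (simp add: p' R_def Re_ip_commute[of "Q v i h" "P v i h"])
  have diff: "(Re (ip H x (R v h)) - Re (ip H x (Q v i h)))\<^sup>2 \<le> defect p i v"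
    if "x \<in> carrier H" "Re (ip H x x) \<le> 1" for x v
    unfolding defect using that by (intro Re_ip_diff_le) auto
  have QR: "Q v i (word_op R w h) = word_op R w (Q v i h)" for v w
    by (rule word_op_commute) (auto simp: R_def comm)
  show thesis
  proof
    show "positive_type m" by fact
    show "\<bar>m w\<bar> \<le> 1" for w
    proof -
      have "(m w)\<^sup>2 \<le> 1"
        using Re_ip_diff_le[of "word_op R w h" h "\<zero>\<^bsub>H\<^esub>"] contr[of w] by (simp add: m_def hh)
      then show ?thesis by (simp add: abs_square_le_1)
    qed
    show "(m (v # w) - m (w @ [v]))\<^sup>2 \<le> 4 * defect p i v" for v w
    proof -
      \<comment> \<open>The letter v is replaced by the commuting Q_{v,i}; n is close to the moments
        with v in front and with v at the back.\<close>
      define n where "n = Re (ip H (word_op R w h) (Q v i h))"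
      have "m (v # w) = Re (ip H (word_op R w h) (R v h))"
        by (simp add: m_def projection_sym)
      then have 1: "(m (v # w) - n)\<^sup>2 \<le> defect p i v"
        using diff[of "word_op R w h" v] contr by (simp add: n_def)
      have "n = Re (ip H (Q v i (word_op R w h)) h)" by (simp add: n_def projection_sym)
      also have "\<dots> = Re (ip H (word_op R (rev w) h) (Q v i h))"
        by (simp add: QR word_op_sym Re_ip_commute[of "Q v i h"])
      finally have "n = Re (ip H (word_op R (rev w) h) (Q v i h))" .
      moreover have "m (w @ [v]) = Re (ip H (word_op R (rev w) h) (R v h))"
        by (simp add: m_def word_op_sym Re_ip_commute[of "R v h"])
      ultimately have 2: "(m (w @ [v]) - n)\<^sup>2 \<le> defect p i v"
        using diff[of "word_op R (rev w) h" v] contr by simp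
      \<comment> \<open>(a + b)^2 <= 2 a^2 + 2 b^2 accounts for the factor 4.\<close>
      have "(m (v # w) - m (w @ [v]))\<^sup>2 \<le> 2 * (m (v # w) - n)\<^sup>2 + 2 * (m (w @ [v]) - n)\<^sup>2"
        using sum_squares_bound[of "m (v # w) - n" "n - m (w @ [v])"]
        by (simp add: power2_eq_square algebra_simps)
      then show ?thesis using 1 2 by linarith
    qed
    show "m [v] = (\<Sum>j\<in>UNIV. p $ (i, j, v, v))" for v
      using m_eq[of "[v]" "[v]"] by (simp add: m_def projection_idem sumQ R_def)
    show "(m [v, w] - p $ (i, i, v, w))\<^sup>2 \<le> defect p i w" for v w
    proof -
      have "m [v, w] = Re (ip H (R v h) (R w h))"
        using m_eq[of "[v]" "[w]"] by simp
      moreover have "p $ (i, i, v, w) = Re (ip H (R v h) (Q w i h))"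
        by (simp add: p' R_def Re_ip_commute[of "Q w i h" "P v i h"])
      moreover have "Re (ip H (R v h) (R v h)) \<le> 1" using contr[of "[v]"] by simp
      ultimately show ?thesis using diff[of "R v h" w] by simp
    qed
  qed
qed

text \<open>Stated for the closure of C_qc so as to serve C_qa and C_qc alike. Moments of an
  approximating sequence are bounded by 1, so a subsequence converges at every word, while the
  defects tend to 0 because p is synchronous.\<close>

lemma closure_C_qc_moments:
  fixes p :: "('i::finite, 'o::finite) corr"
  assumes p: "p \<in> closure (C_qc (U :: 'u itself))" and sync: "synchronous p"
  obtains m :: "'i list \<Rightarrow> real" where "positive_type m" "\<And>v w. m (v # w) = m (w @ [v])"
    "\<And>v. m [v] = p $ (i, i, v, v)" "\<And>v w. m [v, w] = p $ (i, i, v, w)"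
proof -
  obtain q where q: "\<And>n. q n \<in> C_qc U" "q \<longlonglongrightarrow> p"
    using p unfolding closure_sequential by blast
  have "\<exists>m. positive_type m \<and> (\<forall>w. \<bar>m w\<bar> \<le> 1) \<and>
      (\<forall>v w. (m (v # w) - m (w @ [v]))\<^sup>2 \<le> 4 * defect (q n) i v) \<and>
      (\<forall>v. m [v] = (\<Sum>j\<in>UNIV. q n $ (i, j, v, v))) \<and>
      (\<forall>v w. (m [v, w] - q n $ (i, i, v, w))\<^sup>2 \<le> defect (q n) i w)" for n
    by (rule C_qc_moments[OF q(1)[of n], of i]) blast
  then obtain m where m: "\<And>n. positive_type (m n)" "\<And>n w. \<bar>m n w\<bar> \<le> 1"
      "\<And>n v w. (m n (v # w) - m n (w @ [v]))\<^sup>2 \<le> 4 * defect (q n) i v"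
      "\<And>n v. m n [v] = (\<Sum>j\<in>UNIV. q n $ (i, j, v, v))"
      "\<And>n v w. (m n [v, w] - q n $ (i, i, v, w))\<^sup>2 \<le> defect (q n) i w"
    by metis
  \<comment> \<open>Compact by Tychonoff. There are only countably many words, so the product is
    first countable and compactness yields convergent subsequences.\<close>
  define K where "K = (\<Pi>\<^sub>E (w :: 'i list) \<in> UNIV. {-1..1 :: real})"
  have "compactin (product_topology (\<lambda>i. euclidean) UNIV) K"
    unfolding K_def by (subst compactin_PiE) simp
  then have "seq_compact K"
    by (intro compact_imp_seq_compact) (simp add: euclidean_product_topology)
  moreover have "m n \<in> K" for n
    using m(2)[of n] by (auto simp: K_def abs_le_iff minus_le_iff)
  ultimately obtain l r where r: "strict_mono r" and lim: "(m \<circ> r) \<longlonglongrightarrow> l"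
    unfolding seq_compact_def by blast
  have l: "(\<lambda>n. m (r n) w) \<longlonglongrightarrow> l w" for w
    using continuous_on_tendsto_compose[OF continuous_on_product_coordinates lim, of w]
    by (simp add: comp_def)
  have q': "(\<lambda>n. q (r n) $ k) \<longlonglongrightarrow> p $ k" for k
    using LIMSEQ_subseq_LIMSEQ[OF q(2) r] by (auto simp: comp_def intro: tendsto_vec_nth)
  have sum1: "(\<Sum>j\<in>UNIV. p $ (i, j, v, v)) = p $ (i, i, v, v)" for v
    using sync by (subst sum.remove[of _ i]) (auto simp: synchronous_def)
  have sum2: "(\<Sum>j\<in>UNIV. p $ (j, i, v, v)) = p $ (i, i, v, v)" for v
    using sync by (subst sum.remove[of _ i]) (auto simp: synchronous_def)
  have d: "(\<lambda>n. defect (q (r n)) i v) \<longlonglongrightarrow> 0" for v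
  proof -
    have "(\<lambda>n. defect (q (r n)) i v) \<longlonglongrightarrow> defect p i v"
      unfolding defect_def by (intro tendsto_intros q')
    then show ?thesis by (simp add: defect_def sum1 sum2)
  qed
  \<comment> \<open>Sequences whose squared distance is dominated by the defects share their limit;
    used for rotated words and for two-letter moments.\<close>
  have eq: "x = y" if "(\<lambda>n. f n) \<longlonglongrightarrow> x" "(\<lambda>n. g n) \<longlonglongrightarrow> y"
    "\<And>n. (f n - g n)\<^sup>2 \<le> c * defect (q (r n)) i v" for f g :: "nat \<Rightarrow> real" and x y c v
  proof -
    have "(\<lambda>n. (f n - g n)\<^sup>2) \<longlonglongrightarrow> (x - y)\<^sup>2"
      by (intro tendsto_intros that)
    moreover have "(\<lambda>n. c * defect (q (r n)) i v) \<longlonglongrightarrow> c * 0"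
      by (intro tendsto_intros d)
    ultimately have "(x - y)\<^sup>2 \<le> c * 0"
      by (rule LIMSEQ_le) (use that(3) in blast)
    then show ?thesis by simp
  qed
  show thesis
  proof
    show "positive_type l"
      unfolding positive_type_def
    proof (intro conjI allI)
      show "l [] = 1"
        using LIMSEQ_unique[OF l[of "[]"]] m(1) by (simp add: positive_type_def)
      show "l (u @ x # x # v) = l (u @ x # v)" for u x v
        using LIMSEQ_unique[OF l[of "u @ x # x # v"]] l[of "u @ x # v"] m(1)
        by (simp add: positive_type_def)
      show "l (rev w) = l w" for w
        using LIMSEQ_unique[OF l[of "rev w"]] l[of w] m(1) by (simp add: positive_type_def)
      show "0 \<le> (\<Sum>(a, u)\<leftarrow>L. \<Sum>(b, w)\<leftarrow>L. a * b * l (rev u @ w))" for L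
      proof (rule LIMSEQ_le_const)
        have inner: "(\<lambda>n. \<Sum>(b, w)\<leftarrow>L'. a * b * m (r n) (rev u @ w)) \<longlonglongrightarrow>
            (\<Sum>(b, w)\<leftarrow>L'. a * b * l (rev u @ w))" for a u L'
          by (induction L') (auto intro!: tendsto_intros l)
        have "(\<lambda>n. \<Sum>(a, u)\<leftarrow>L'. \<Sum>(b, w)\<leftarrow>L. a * b * m (r n) (rev u @ w)) \<longlonglongrightarrow>
            (\<Sum>(a, u)\<leftarrow>L'. \<Sum>(b, w)\<leftarrow>L. a * b * l (rev u @ w))" for L'
          by (induction L') (auto intro!: tendsto_intros inner)
        then show "(\<lambda>n. \<Sum>(a, u)\<leftarrow>L. \<Sum>(b, w)\<leftarrow>L. a * b * m (r n) (rev u @ w)) \<longlonglongrightarrow>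
            (\<Sum>(a, u)\<leftarrow>L. \<Sum>(b, w)\<leftarrow>L. a * b * l (rev u @ w))" .
      qed (use m(1) in \<open>auto simp: positive_type_def\<close>)
    qed
    show "l (v # w) = l (w @ [v])" for v w
      by (rule eq[OF l l]) (rule m(3))
    show "l [v] = p $ (i, i, v, v)" for v
    proof -
      have "(\<lambda>n. \<Sum>j\<in>UNIV. q (r n) $ (i, j, v, v)) \<longlonglongrightarrow> (\<Sum>j\<in>UNIV. p $ (i, j, v, v))"
        by (intro tendsto_intros q')
      then show ?thesis using LIMSEQ_unique[OF l[of "[v]"]] by (simp add: m(4) sum1)
    qed
    show "l [v, w] = p $ (i, i, v, w)" for v w
    proof -
      have "(m (r n) [v, w] - q (r n) $ (i, i, v, w))\<^sup>2 \<le> 1 * defect (q (r n)) i w" for n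
        using m(5) by simp
      then show ?thesis by (rule eq[OF l q'])
    qed
  qed
qed


section \<open>Tensor products\<close>

context complex_hilbert_space
begin

lemma smult_zero: "x \<in> carrier H \<Longrightarrow> 0 \<odot> x = \<zero>"
  using smult_l_null[of x] by (simp add: ring_of_type_algebra_def)

lemma smult_finsum:
  "finite A \<Longrightarrow> f \<in> A \<rightarrow> carrier H \<Longrightarrow> c \<odot> (\<Oplus>i\<in>A. f i) = (\<Oplus>i\<in>A. c \<odot> f i)"
  by (induction A rule: finite_induct) (auto simp: Pi_iff smult_r_distr)

lemma linear_op_closed: "linear_op H T \<Longrightarrow> x \<in> carrier H \<Longrightarrow> T x \<in> carrier H"
  by (auto simp: linear_op_def)

lemma linear_op_zero: "linear_op H T \<Longrightarrow> T \<zero> = \<zero>"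
  by (metis linear_op_def M.zero_closed linear_op_closed smult_zero)

lemma linear_op_finsum:
  assumes "\<And>i. linear_op H (T i)"
  shows "linear_op H (\<lambda>x. \<Oplus>i\<in>(UNIV :: 'i::finite set). T i x)"
  unfolding linear_op_def
  using assms
  by (auto simp: linear_op_def smult_finsum Pi_iff intro!: M.finsum_closed M.finsum_addf)

lemma linear_op_comp: "linear_op H S \<Longrightarrow> linear_op H T \<Longrightarrow> linear_op H (\<lambda>x. S (T x))"
  by (auto simp: linear_op_def Pi_iff)

lemma linear_op_id: "linear_op H (\<lambda>x. x)"
  by (auto simp: linear_op_def)

end

locale hilbert_tensor =
  HA: complex_hilbert_space HA + HB: complex_hilbert_space HB
  for HA HB :: "'u hilb" and K :: "'u hilb" and \<tau> :: "'u \<Rightarrow> 'u \<Rightarrow> 'u" +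
  assumes tensor: "tensor_product HA HB K \<tau>"
begin

sublocale K: complex_hilbert_space K
  using tensor by (simp add: tensor_product_def)

lemma tau_closed [simp, intro]: "a \<in> carrier HA \<Longrightarrow> b \<in> carrier HB \<Longrightarrow> \<tau> a b \<in> carrier K"
  using tensor by (simp add: tensor_product_def)

lemma tau_add_left: "\<lbrakk>a \<in> carrier HA; a' \<in> carrier HA; b \<in> carrier HB\<rbrakk> \<Longrightarrow>
    \<tau> (a \<oplus>\<^bsub>HA\<^esub> a') b = \<tau> a b \<oplus>\<^bsub>K\<^esub> \<tau> a' b"
  using tensor unfolding tensor_product_def by blast

lemma tau_add_right: "\<lbrakk>a \<in> carrier HA; b \<in> carrier HB; b' \<in> carrier HB\<rbrakk> \<Longrightarrow>
    \<tau> a (b \<oplus>\<^bsub>HB\<^esub> b') = \<tau> a b \<oplus>\<^bsub>K\<^esub> \<tau> a b'"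
  using tensor unfolding tensor_product_def by blast

lemma tau_smult: "\<lbrakk>a \<in> carrier HA; b \<in> carrier HB\<rbrakk> \<Longrightarrow> \<tau> (c \<odot>\<^bsub>HA\<^esub> a) b = c \<odot>\<^bsub>K\<^esub> \<tau> a b"
  "\<lbrakk>a \<in> carrier HA; b \<in> carrier HB\<rbrakk> \<Longrightarrow> \<tau> a (c \<odot>\<^bsub>HB\<^esub> b) = c \<odot>\<^bsub>K\<^esub> \<tau> a b"
  using tensor unfolding tensor_product_def by blast+

lemma tau_ip: "\<lbrakk>a \<in> carrier HA; a' \<in> carrier HA; b \<in> carrier HB; b' \<in> carrier HB\<rbrakk> \<Longrightarrow>
    ip K (\<tau> a b) (\<tau> a' b') = ip HA a a' * ip HB b b'"
  using tensor unfolding tensor_product_def by blast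

lemma tau_zero: "b \<in> carrier HB \<Longrightarrow> \<tau> \<zero>\<^bsub>HA\<^esub> b = \<zero>\<^bsub>K\<^esub>" "a \<in> carrier HA \<Longrightarrow> \<tau> a \<zero>\<^bsub>HB\<^esub> = \<zero>\<^bsub>K\<^esub>"
  using tau_smult(1)[of "\<zero>\<^bsub>HA\<^esub>" b 0] tau_smult(2)[of a "\<zero>\<^bsub>HB\<^esub>" 0]
  by (simp_all add: HA.smult_zero HB.smult_zero K.smult_zero)

lemma tau_finsum_left:
  "\<lbrakk>finite I; f \<in> I \<rightarrow> carrier HA; b \<in> carrier HB\<rbrakk> \<Longrightarrow>
    \<tau> (\<Oplus>\<^bsub>HA\<^esub>i\<in>I. f i) b = (\<Oplus>\<^bsub>K\<^esub>i\<in>I. \<tau> (f i) b)"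
  by (induction I rule: finite_induct) (auto simp: Pi_iff tau_zero tau_add_left)

lemma tau_finsum_right:
  "\<lbrakk>finite I; f \<in> I \<rightarrow> carrier HB; a \<in> carrier HA\<rbrakk> \<Longrightarrow>
    \<tau> a (\<Oplus>\<^bsub>HB\<^esub>i\<in>I. f i) = (\<Oplus>\<^bsub>K\<^esub>i\<in>I. \<tau> a (f i))"
  by (induction I rule: finite_induct) (auto simp: Pi_iff tau_zero tau_add_right)

text \<open>Spanning is algebraic and scalars are absorbed into a factor, so zero, sums and
  elementary tensors exhaust the space. Operator identities on \<open>K\<close> are reduced to
  elementary tensors in this way.\<close>

lemma tensor_induct [consumes 1, case_names zero add tau]:
  assumes z: "z \<in> carrier K" and zero: "\<Phi> \<zero>\<^bsub>K\<^esub>"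
    and add: "\<And>x y. \<lbrakk>x \<in> carrier K; y \<in> carrier K; \<Phi> x; \<Phi> y\<rbrakk> \<Longrightarrow> \<Phi> (x \<oplus>\<^bsub>K\<^esub> y)"
    and tau: "\<And>a b. \<lbrakk>a \<in> carrier HA; b \<in> carrier HB\<rbrakk> \<Longrightarrow> \<Phi> (\<tau> a b)"
  shows "\<Phi> z"
proof -
  obtain r :: nat and a b where ab: "\<forall>k<r. a k \<in> carrier HA \<and> b k \<in> carrier HB"
    and z: "z = (\<Oplus>\<^bsub>K\<^esub>k\<in>{..<r}. \<tau> (a k) (b k))"
    using tensor z unfolding tensor_product_def by blast
  have "\<Phi> (\<Oplus>\<^bsub>K\<^esub>k\<in>{..<n}. \<tau> (a k) (b k))" if "n \<le> r" for n
    using that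
  proof (induction n)
    case (Suc n)
    have "(\<Oplus>\<^bsub>K\<^esub>k\<in>{..<n}. \<tau> (a k) (b k)) \<in> carrier K"
      using ab Suc.prems by (intro K.M.finsum_closed) auto
    then show ?case
      using Suc ab by (auto simp: lessThan_Suc Pi_iff intro!: add tau)
  qed (simp add: zero)
  then show ?thesis using z by blast
qed

lemma linear_op_eqI:
  assumes S: "linear_op K S" and T: "linear_op K T"
    and "\<And>a b. \<lbrakk>a \<in> carrier HA; b \<in> carrier HB\<rbrakk> \<Longrightarrow> S (\<tau> a b) = T (\<tau> a b)"
    and "z \<in> carrier K"
  shows "S z = T z"
  using assms(4)
proof (induction rule: tensor_induct)
  case zero
  show ?case by (simp add: K.linear_op_zero[OF S] K.linear_op_zero[OF T])
next
  case (add x y)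
  then show ?case using S T by (simp add: linear_op_def)
qed (rule assms(3))

lemma projection_tensor:
  assumes A: "linear_op K A"
    and S: "projection HA S" and T: "projection HB T"
    and AST: "\<And>a b. \<lbrakk>a \<in> carrier HA; b \<in> carrier HB\<rbrakk> \<Longrightarrow> A (\<tau> a b) = \<tau> (S a) (T b)"
  shows "projection K A"
  unfolding projection_def
proof (intro conjI ballI)
  note [simp] = HA.projection_closed[OF S] HB.projection_closed[OF T] AST
  show "A (A x) = A x" if "x \<in> carrier K" for x
    by (rule linear_op_eqI[OF K.linear_op_comp[OF A A] A _ that])
      (simp add: HA.projection_idem[OF S] HB.projection_idem[OF T])
  \<comment> \<open>Both sides are additive in x and in y, hence two nested inductions.\<close>
  show "ip K (A x) y = ip K x (A y)" if "x \<in> carrier K" "y \<in> carrier K" for x y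
    using that(1)
  proof (induction rule: tensor_induct)
    case zero
    show ?case
      using that by (simp add: K.linear_op_zero[OF A] K.linear_op_closed[OF A])
  next
    case (add x x')
    then show ?case
      using A that K.linear_op_closed[OF A] by (simp add: linear_op_def K.ip_add)
  next
    case (tau a b)
    show ?case
      using that(2)
    proof (induction rule: tensor_induct)
      case zero
      show ?case
        using tau by (simp add: K.linear_op_zero[OF A])
    next
      case (add y y')
      then show ?case
        using A tau K.linear_op_closed[OF A] by (simp add: linear_op_def K.ip_add_right)
    next
      case (tau a' b')
      then show ?case
        using \<open>a \<in> carrier HA\<close> \<open>b \<in> carrier HB\<close>
        by (simp add: tau_ip HA.projection_sym[OF S] HB.projection_sym[OF T])
    qed
  qed
qed (rule A)

lemma pvm_tensor:
  fixes A :: "'o::finite \<Rightarrow> 'u \<Rightarrow> 'u"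
  assumes "\<And>i. projection K (A i)"
    and "\<And>a b. \<lbrakk>a \<in> carrier HA; b \<in> carrier HB\<rbrakk> \<Longrightarrow> (\<Oplus>\<^bsub>K\<^esub>i\<in>UNIV. A i (\<tau> a b)) = \<tau> a b"
  shows "pvm K A"
  unfolding pvm_def
proof (intro conjI allI ballI assms(1))
  show "(\<Oplus>\<^bsub>K\<^esub>i\<in>UNIV. A i x) = x" if "x \<in> carrier K" for x
    using assms by (intro linear_op_eqI[OF K.linear_op_finsum K.linear_op_id _ that])
      (auto simp: projection_def)
qed

end

lemma projection_id: "complex_hilbert_space H \<Longrightarrow> projection H (\<lambda>x. x)"
  by (simp add: projection_def complex_hilbert_space.linear_op_id)

text \<open>The definition of C_q supplies one operator for each choice of outcomes and inputs, and
  no operator of a single party on \<open>K\<close>. P tensor identity is recovered by summing over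
  the other party's outcomes at one input, since a PVM sums to the identity.\<close>

lemma C_q_subset_C_qc: "C_q (U :: 'u itself) \<subseteq> (C_qc U :: ('i::finite, 'o::finite) corr set)"
proof
  fix p :: "('i, 'o) corr" assume p: "p \<in> C_q U"
  from p obtain HA HB K :: "'u hilb" and \<tau> P Q h where
    "complex_hilbert_space HA" "complex_hilbert_space HB" "tensor_product HA HB K \<tau>"
    and P': "\<forall>v. pvm HA (P v)" and Q': "\<forall>w. pvm HB (Q w)" and h: "unit_vector K h"
    and R': "\<forall>i j v w. \<exists>R. is_tensor_op HA HB K \<tau> (P v i) (Q w j) R \<and>
        complex_of_real (p $ (i, j, v, w)) = ip K (R h) h"
    unfolding C_q_def mem_Collect_eq by (elim conjE exE)
  then interpret hilbert_tensor HA HB K \<tau> by (simp add: hilbert_tensor_def hilbert_tensor_axioms_def)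
  obtain R where R: "\<And>i j v w. is_tensor_op HA HB K \<tau> (P v i) (Q w j) (R i j v w)"
    "\<And>i j v w. complex_of_real (p $ (i, j, v, w)) = ip K (R i j v w h) h"
    using R' by metis
  have P: "projection HA (P v i)" and Q: "projection HB (Q v i)"
    and sumP: "a \<in> carrier HA \<Longrightarrow> (\<Oplus>\<^bsub>HA\<^esub>i\<in>UNIV. P v i a) = a"
    and sumQ: "b \<in> carrier HB \<Longrightarrow> (\<Oplus>\<^bsub>HB\<^esub>i\<in>UNIV. Q v i b) = b" for v i a b
    using P' Q' by (auto simp: pvm_def)
  note [simp] = HA.projection_closed[OF P] HB.projection_closed[OF Q]
  have Rlin: "linear_op K (R i j v w)" for i j v w
    using R(1) by (simp add: is_tensor_op_def)
  have Rtau: "R i j v w (\<tau> a b) = \<tau> (P v i a) (Q w j b)"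
    if "a \<in> carrier HA" "b \<in> carrier HB" for i j v w a b
    using R(1)[of v i w j] that unfolding is_tensor_op_def by blast
  \<comment> \<open>\<open>undefined\<close> stands for an arbitrary fixed input of the other
    party.\<close>
  define A where "A v i x = (\<Oplus>\<^bsub>K\<^esub>j\<in>UNIV. R i j v undefined x)" for v i x
  define B where "B w j x = (\<Oplus>\<^bsub>K\<^esub>i\<in>UNIV. R i j undefined w x)" for w j x
  have Alin: "linear_op K (A v i)" and Blin: "linear_op K (B v i)" for v i
    unfolding A_def[abs_def] B_def[abs_def] by (intro K.linear_op_finsum Rlin)+
  have Atau: "A v i (\<tau> a b) = \<tau> (P v i a) b" and Btau: "B v i (\<tau> a b) = \<tau> a (Q v i b)"
    if "a \<in> carrier HA" "b \<in> carrier HB" for v i a b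
    using that by (simp_all add: A_def B_def Rtau Pi_iff sumP sumQ
      tau_finsum_left[symmetric] tau_finsum_right[symmetric])
  have Aproj: "projection K (A v i)" for v i
    by (rule projection_tensor[OF Alin P projection_id]) (auto simp: Atau HB.complex_hilbert_space_axioms)
  have Bproj: "projection K (B v i)" for v i
    by (rule projection_tensor[OF Blin projection_id Q]) (auto simp: Btau HA.complex_hilbert_space_axioms)
  have "pvm K (A v)" for v
    by (rule pvm_tensor[OF Aproj]) (simp add: Atau tau_finsum_left[symmetric] Pi_iff sumP)
  moreover have "pvm K (B v)" for v
    by (rule pvm_tensor[OF Bproj]) (simp add: Btau tau_finsum_right[symmetric] Pi_iff sumQ)
  moreover have "A v i (B w j x) = B w j (A v i x)" if "x \<in> carrier K" for v w i j x
    by (rule linear_op_eqI[OF K.linear_op_comp[OF Alin Blin] K.linear_op_comp[OF Blin Alin] _ that])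
      (simp add: Atau Btau)
  moreover have "A v i (B w j x) = R i j v w x" if "x \<in> carrier K" for v w i j x
    by (rule linear_op_eqI[OF K.linear_op_comp[OF Alin Blin] Rlin _ that])
      (simp add: Atau Btau Rtau)
  moreover have "h \<in> carrier K" using h by (simp add: unit_vector_def)
  ultimately show "p \<in> C_qc U"
    using p h R(2) K.complex_hilbert_space_axioms unfolding C_qc_def C_q_def
    by (intro CollectI conjI exI[of _ K] exI[of _ A] exI[of _ B] exI[of _ h]) auto
qed


section \<open>Bounds for synchronous correlations\<close>

lemma UNIV_two: "(UNIV :: 2 set) = {0, 1}"
  using UNIV_2 by auto

lemma UNIV_three: "(UNIV :: 3 set) = {0, 1, 2}"
  using UNIV_3 by auto

lemma two_eq_zero: "(2 :: 2) = 0" and three_eq_zero: "(3 :: 3) = 0"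
  by simp_all

lemma sum_two: "sum f (UNIV :: 2 set) = f 0 + f 1"
  by (simp add: UNIV_two)

lemma sum_three: "sum f (UNIV :: 3 set) = f 0 + f 1 + f 2"
  by (simp add: sum_3 three_eq_zero ac_simps)

definition no_signalling :: "('i::finite, 'o::finite) corr \<Rightarrow> bool" where
  "no_signalling p \<longleftrightarrow>
    (\<forall>i v w w'. (\<Sum>j\<in>UNIV. p $ (i, j, v, w)) = (\<Sum>j\<in>UNIV. p $ (i, j, v, w'))) \<and>
    (\<forall>j v v' w. (\<Sum>i\<in>UNIV. p $ (i, j, v, w)) = (\<Sum>i\<in>UNIV. p $ (i, j, v', w)))"

text \<open>Summing over one party's outcomes replaces its vector by h. Covers the commuting case,
  with vectors P_{v,i} h and Q_{w,j} h, and the vector case.\<close>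

lemma (in complex_hilbert_space) no_signallingI:
  fixes p :: "('i::finite, 'o::finite) corr"
  assumes x: "\<And>v i. x v i \<in> carrier H" "\<And>v. (\<Oplus>i\<in>UNIV. x v i) = h"
    and y: "\<And>v i. y v i \<in> carrier H" "\<And>v. (\<Oplus>i\<in>UNIV. y v i) = h"
    and p: "\<And>i j v w. p $ (i, j, v, w) = Re (ip H (x v i) (y w j))"
  shows "no_signalling p"
proof -
  have "(\<Sum>j\<in>UNIV. p $ (i, j, v, w)) = Re (ip H h (x v i))" for i v w
    using ip_finsum_left[of UNIV "y w" "x v i"] x y by (simp add: p Pi_iff Re_ip_commute)
  moreover have "(\<Sum>i\<in>UNIV. p $ (i, j, v, w)) = Re (ip H h (y w j))" for j v w
    using ip_finsum_left[of UNIV "x v" "y w j"] x y by (simp add: p Pi_iff)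
  ultimately show ?thesis by (simp add: no_signalling_def)
qed

lemma C_qc_no_signalling:
  assumes "p \<in> C_qc (U :: 'u itself)" shows "no_signalling p"
proof -
  from assms obtain H :: "'u hilb" and P Q h where "complex_hilbert_space H"
    and P: "\<forall>v. pvm H (P v)" and Q: "\<forall>w. pvm H (Q w)" and h: "unit_vector H h"
    and comm: "\<forall>v w i j. \<forall>x\<in>carrier H. P v i (Q w j x) = Q w j (P v i x)"
    and p: "\<forall>i j v w. complex_of_real (p $ (i, j, v, w)) = ip H (P v i (Q w j h)) h"
    unfolding C_qc_def mem_Collect_eq by (elim conjE exE)
  interpret complex_hilbert_space H by fact
  have h: "h \<in> carrier H" using h by (simp add: unit_vector_def)
  have proj: "projection H (P v i)" "projection H (Q v i)" for v i
    using P Q by (auto simp: pvm_def)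
  have "p $ (i, j, v, w) = Re (ip H (P v i h) (Q w j h))" for i j v w
  proof -
    have "p $ (i, j, v, w) = Re (ip H (P v i (Q w j h)) h)"
      using p by (metis Re_complex_of_real)
    then show ?thesis
      using comm proj h by (simp add: projection_closed projection_sym)
  qed
  then show ?thesis
    using P Q proj h by (intro no_signallingI) (auto simp: pvm_def projection_closed)
qed

lemma C_vect_no_signalling:
  assumes "p \<in> C_vect (U :: 'u itself)" shows "no_signalling p"
proof -
  from assms obtain H :: "'u hilb" and x y h where "complex_hilbert_space H"
    and x: "\<forall>v i. x v i \<in> carrier H" "\<forall>v. (\<Oplus>\<^bsub>H\<^esub>i\<in>UNIV. x v i) = h"
    and y: "\<forall>v i. y v i \<in> carrier H" "\<forall>v. (\<Oplus>\<^bsub>H\<^esub>i\<in>UNIV. y v i) = h"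
    and p: "\<forall>i j v w. 0 \<le> p $ (i, j, v, w) \<and> complex_of_real (p $ (i, j, v, w)) = ip H (x v i) (y w j)"
    unfolding C_vect_def mem_Collect_eq by (elim conjE exE)
  interpret complex_hilbert_space H by fact
  have "p $ (i, j, v, w) = Re (ip H (x v i) (y w j))" for i j v w
    using p by (metis Re_complex_of_real)
  then show ?thesis using x y by (intro no_signallingI) auto
qed

text \<open>Weak inequalities and equations in finitely many coordinates, hence inherited by limits
  such as the elements of C_qa.\<close>

lemma closed_no_signalling_correlations:
  "closed {p :: ('i::finite, 'o::finite) corr. correlation p \<and> no_signalling p}"
  unfolding correlation_def no_signalling_def
  by (intro closed_Collect_conj closed_Collect_all closed_Collect_le closed_Collect_eq
      continuous_intros)

lemma closure_C_qc_correlation: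
  assumes "p \<in> closure (C_qc (U :: 'u itself))"
  shows "correlation p" "no_signalling p"
proof -
  have "C_qc U \<subseteq> {p. correlation p \<and> no_signalling p}"
  proof
    show "p \<in> {p. correlation p \<and> no_signalling p}" if "p \<in> C_qc U" for p
      using C_qc_no_signalling[OF that] that by (auto simp: C_qc_def)
  qed
  then have "closure (C_qc U) \<subseteq> {p. correlation p \<and> no_signalling p}"
    by (intro closure_minimal closed_no_signalling_correlations)
  then show "correlation p" "no_signalling p" using assms by auto
qed

locale sync_correlation =
  fixes p :: "(3, 2) corr"
  assumes corr: "correlation p" and ns: "no_signalling p" and sync: "synchronous p"
begin

definition overlap :: "2 \<Rightarrow> real" where
  "overlap i = p $ (i, i, 0, 1) + p $ (i, i, 1, 2) + p $ (i, i, 2, 0)"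

lemma nonneg: "0 \<le> p $ k"
  using corr by (cases k) (auto simp: correlation_def)

lemma sync_zero: "p $ (0, 1, v, v) = 0" "p $ (1, 0, v, v) = 0"
  using sync by (auto simp: synchronous_def)

lemma marginals:
  "p $ (0, 0, v, w) + p $ (0, 1, v, w) = p $ (0, 0, v, v)"
  "p $ (0, 0, v, w) + p $ (1, 0, v, w) = p $ (0, 0, w, w)"
  "p $ (0, 0, v, w) + p $ (0, 1, v, w) + p $ (1, 0, v, w) + p $ (1, 1, v, w) = 1"
proof -
  have "(\<Sum>j\<in>UNIV. p $ (0, j, v, w)) = (\<Sum>j\<in>UNIV. p $ (0, j, v, v))"
    "(\<Sum>i\<in>UNIV. p $ (i, 0, v, w)) = (\<Sum>i\<in>UNIV. p $ (i, 0, w, w))"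
    using ns unfolding no_signalling_def by blast+
  then show "p $ (0, 0, v, w) + p $ (0, 1, v, w) = p $ (0, 0, v, v)"
    "p $ (0, 0, v, w) + p $ (1, 0, v, w) = p $ (0, 0, w, w)"
    by (simp_all add: sum_two sync_zero)
  have "(\<Sum>i\<in>UNIV. \<Sum>j\<in>UNIV. p $ (i, j, v, w)) = 1"
    using corr by (simp add: correlation_def)
  then show "p $ (0, 0, v, w) + p $ (0, 1, v, w) + p $ (1, 0, v, w) + p $ (1, 1, v, w) = 1"
    by (simp add: sum_two)
qed

lemma theta_eq: "3 * theta p = p $ (0, 0, 0, 0) + p $ (0, 0, 1, 1) + p $ (0, 0, 2, 2)"
  by (simp add: theta_def sum_three)

lemma one_minus_theta_eq:
  "3 - 3 * theta p = p $ (1, 1, 0, 0) + p $ (1, 1, 1, 1) + p $ (1, 1, 2, 2)"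
  using marginals(3)[of 0 0] marginals(3)[of 1 1] marginals(3)[of 2 2]
  by (simp add: theta_eq right_diff_distrib sync_zero)

text \<open>Rests on p(1,1|v,w) = 1 - a(v,v) - a(w,w) + a(v,w). It allows a bound proved for either
  outcome to be reused for the other, with theta replaced by 1 - theta.\<close>

lemma overlap_one: "overlap 1 = 3 - 6 * theta p + overlap 0"
  using marginals[of 0 1] marginals[of 1 2] marginals[of 2 0] theta_eq
  by (simp add: overlap_def)

lemma theta_tilde_eq: "theta_tilde p = 1 / 2 + theta p - overlap 0 / 3"
proof -
  have "6 * theta_tilde p = 3 + 6 * theta p - 2 * overlap 0"
  using marginals[of 0 1] marginals[of 1 2] marginals[of 2 0]
    marginals(3)[of 0 0] marginals(3)[of 1 1] marginals(3)[of 2 2] theta_eq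
  by (simp add: overlap_def theta_tilde_def sum_three sum_two sync_zero
      two_eq_zero three_eq_zero)
  then show ?thesis by linarith
qed

lemma basic_bounds:
  "0 \<le> theta p" "theta p \<le> 1" "1 / 2 \<le> theta_tilde p"
  "theta_tilde p \<le> 1 / 2 + theta p" "theta_tilde p \<le> 3 / 2 - theta p"
proof -
  have o: "0 \<le> overlap i" for i by (simp add: overlap_def nonneg)
  show "0 \<le> theta p" "theta p \<le> 1"
    using theta_eq one_minus_theta_eq nonneg[of "(0, 0, 0, 0)"] nonneg[of "(0, 0, 1, 1)"]
      nonneg[of "(0, 0, 2, 2)"] nonneg[of "(1, 1, 0, 0)"] nonneg[of "(1, 1, 1, 1)"]
      nonneg[of "(1, 1, 2, 2)"] by linarith+
  show "theta_tilde p \<le> 1 / 2 + theta p" "theta_tilde p \<le> 3 / 2 - theta p"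
    using o[of 0] o[of 1] overlap_one by (simp_all add: theta_tilde_eq)
  have "overlap 0 \<le> 3 * theta p"
    using marginals(1)[of 0 1] marginals(1)[of 1 2] marginals(1)[of 2 0]
      nonneg[of "(0, 1, 0, 1)"] nonneg[of "(0, 1, 1, 2)"] nonneg[of "(0, 1, 2, 0)"]
    by (simp add: overlap_def theta_eq)
  then show "1 / 2 \<le> theta_tilde p" by (simp add: theta_tilde_eq)
qed

lemma tracial_bounds:
  assumes p: "p \<in> closure (C_qc (U :: 'u itself))"
  shows "theta_tilde p \<le> (3 + theta p) / 4" "theta_tilde p \<le> (4 - theta p) / 4"
proof -
  have *: "3 / 4 * (p $ (i, i, 0, 0) + p $ (i, i, 1, 1) + p $ (i, i, 2, 2) - 1) \<le> overlap i" for i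
  proof -
    obtain m :: "3 list \<Rightarrow> real" where m: "positive_type m" "\<And>v w. m (v # w) = m (w @ [v])"
      "\<And>v. m [v] = p $ (i, i, v, v)" "\<And>v w. m [v, w] = p $ (i, i, v, w)"
      using closure_C_qc_moments[OF p sync, of i] by blast
    \<comment> \<open>The certificate is evaluated with natural numbers as letters;
      \<open>of_nat\<close> carries 0, 1, 2 to the three inputs.\<close>
    define m' where "m' w = m (map of_nat w)" for w
    have "tracial m'"
      unfolding tracial_def
    proof (intro conjI allI)
      show "0 \<le> (\<Sum>(a, u)\<leftarrow>L. \<Sum>(b, w)\<leftarrow>L. a * b * m' (rev u @ w))" for L
      proof -
        have "0 \<le> (\<Sum>(a, u)\<leftarrow>map (map_prod id (map of_nat)) L.
            \<Sum>(b, w)\<leftarrow>map (map_prod id (map of_nat)) L. a * b * m (rev u @ w))"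
          using m(1) unfolding positive_type_def by blast
        then show ?thesis
          by (simp add: comp_def case_prod_unfold m'_def rev_map)
      qed
      show "m' (rev w) = m' w" for w
        using m(1) by (simp add: m'_def positive_type_def flip: rev_map)
    qed (use m(1,2) in \<open>simp_all add: m'_def positive_type_def\<close>)
    from tracial_sum_bound[OF this] show ?thesis
      by (simp add: m'_def m(3,4) overlap_def)
  qed
  show "theta_tilde p \<le> (3 + theta p) / 4"
    using *[of 0] theta_eq by (simp add: theta_tilde_eq)
  show "theta_tilde p \<le> (4 - theta p) / 4"
    using *[of 1] one_minus_theta_eq overlap_one by (simp add: theta_tilde_eq)
qed

lemma vector_bound:
  assumes p: "p \<in> C_vect (U :: 'u itself)"
  shows "theta_tilde p \<le> (1 + 3 * theta p - 3 * (theta p)\<^sup>2) / 2"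
proof -
  from p obtain H :: "'u hilb" and x y h where "complex_hilbert_space H"
    and x': "\<forall>v i. x v i \<in> carrier H" and y': "\<forall>v i. y v i \<in> carrier H" and h': "unit_vector H h"
    and ox: "\<forall>v i j. i \<noteq> j \<longrightarrow> ip H (x v i) (x v j) = 0"
    and oy: "\<forall>v i j. i \<noteq> j \<longrightarrow> ip H (y v i) (y v j) = 0"
    and sx: "\<forall>v. (\<Oplus>\<^bsub>H\<^esub>i\<in>UNIV. x v i) = h" and sy: "\<forall>v. (\<Oplus>\<^bsub>H\<^esub>i\<in>UNIV. y v i) = h"
    and p': "\<forall>i j v w. 0 \<le> p $ (i, j, v, w) \<and> complex_of_real (p $ (i, j, v, w)) = ip H (x v i) (y w j)"
    unfolding C_vect_def mem_Collect_eq by (elim conjE exE)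
  interpret complex_hilbert_space H by fact
  have p'': "p $ (i, j, v, w) = Re (ip H (x v i) (y w j))" for i j v w
    using p' by (metis Re_complex_of_real)
  have [simp]: "x v i \<in> carrier H" "y v i \<in> carrier H" "h \<in> carrier H" for v i
    using x' y' h' by (auto simp: unit_vector_def)
  have hh: "Re (ip H h h) = 1" using h' by (simp add: unit_vector_def hnorm_def)
  have hx: "ip H h z = ip H (x v 0) z + ip H (x v 1) z"
    and hy: "ip H h z = ip H (y v 0) z + ip H (y v 1) z" if "z \<in> carrier H" for v z
    using ip_finsum_left[of UNIV "x v" z] ip_finsum_left[of UNIV "y v" z] sx sy that
    by (simp_all add: Pi_iff sum_two)
  have hx0: "Re (ip H h (x v 0)) = p $ (0, 0, v, v)" for v
    using hy[of "x v 0" v] p''[of 0 0 v v] p''[of 0 1 v v]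
    by (simp add: Re_ip_commute[of "y v _" "x v 0"] sync_zero)
  have xx: "Re (ip H (x v 0) (x v 0)) = p $ (0, 0, v, v)" for v
    using hx[of "x v 0" v] ox hx0[of v] by simp
  have yy: "Re (ip H (y v 0) (y v 0)) = p $ (0, 0, v, v)" for v
    using hx[of "y v 0" v] hy[of "y v 0" v] oy p''[of 0 0 v v] p''[of 1 0 v v]
    by (simp add: sync_zero)
  have le1: "p $ (0, 0, v, v) \<le> 1" for v
    using marginals(3)[of v v] nonneg[of "(1, 1, v, v)"] by (simp add: sync_zero)
  \<comment> \<open>x_{w,0} and y_{w,0} have squared norms and inner product all equal to
    p(0,0|w,w), so they coincide; p thus becomes a Gram matrix of the x alone.\<close>
  have xw: "Re (ip H (x v 0) (x w 0)) = p $ (0, 0, v, w)" for v w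
    using Re_ip_diff_le[of "x v 0" "x w 0" "y w 0"] le1[of v]
    by (simp add: xx yy p''[symmetric])
  have symm: "p $ (0, 0, v, w) = p $ (0, 0, w, v)" for v w
    using xw[of v w] xw[of w v] Re_ip_commute[of "x v 0" "x w 0"] by simp
  have xh: "Re (ip H (x v 0) h) = p $ (0, 0, v, v)" for v
    using hx0[of v] Re_ip_commute[of h "x v 0"] by simp
  have gram: "0 \<le> 3 * theta p + 2 * overlap 0 + c * c - 2 * (c * p $ (0, 0, 0, 0) +
      c * p $ (0, 0, 1, 1) + c * p $ (0, 0, 2, 2))" for c
    using gram_nonneg[of "[(1, x 0 0), (1, x 1 0), (1, x 2 0), (- c, h)]"]
      symm[of 1 0] symm[of 2 1] symm[of 0 2]
    by (simp add: xw xh hx0 hh overlap_def theta_eq)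
  have *: "c * p $ (0, 0, 0, 0) + c * p $ (0, 0, 1, 1) + c * p $ (0, 0, 2, 2) = c * (3 * theta p)" for c
    by (simp add: theta_eq distrib_left)
  \<comment> \<open>c = 3 theta minimises the quadratic in c.\<close>
  have "0 \<le> 3 * theta p + 2 * overlap 0 - 9 * (theta p * theta p)"
    using gram[of "3 * theta p"] unfolding * by simp
  then show ?thesis unfolding theta_tilde_eq power2_eq_square
    by (simp add: add_divide_distrib diff_divide_distrib)
qed

end


section \<open>Coordinate spaces\<close>

text \<open>An index below d * d encodes the pair of its quotient and remainder, the coordinate form
  of a tensor product.\<close>

lemma sum_div_mod:
  fixes f :: "nat \<Rightarrow> nat \<Rightarrow> 'a::comm_monoid_add"
  shows "(\<Sum>n<d * d. f (n div d) (n mod d)) = (\<Sum>i<d. \<Sum>j<d. f i j)"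
proof (cases "d = 0")
  case False
  have "(\<Sum>n<d * d. f (n div d) (n mod d)) = (\<Sum>i<d. \<Sum>n = i * d..<i * d + d. f (n div d) (n mod d))"
    by (rule sum.nat_group[symmetric])
  also have "\<dots> = (\<Sum>i<d. \<Sum>j<d. f i j)"
  proof (rule sum.cong[OF refl])
    fix i
    have "(\<Sum>n = i * d..<i * d + d. f (n div d) (n mod d)) = (\<Sum>j = 0..<d. f ((j + i * d) div d) ((j + i * d) mod d))"
      using sum.shift_bounds_nat_ivl[of "\<lambda>n. f (n div d) (n mod d)" 0 "i * d" d] by (simp add: add.commute)
    also have "\<dots> = (\<Sum>j<d. f i j)"
      using False by (intro sum.cong) auto
    finally show "(\<Sum>n = i * d..<i * d + d. f (n div d) (n mod d)) = (\<Sum>j<d. f i j)" .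
  qed
  finally show ?thesis .
qed simp

text \<open>One injection hosts all dimensions: a d-dimensional space consists of the sequences that
  vanish from d on, so a space and its tensor square live in the same type.\<close>

locale universe =
  fixes e :: "(nat \<Rightarrow> complex) \<Rightarrow> 'u"
  assumes inj: "inj e"
begin

abbreviation dec :: "'u \<Rightarrow> nat \<Rightarrow> complex" where "dec \<equiv> inv_into UNIV e"

lemma dec_e [simp]: "dec (e f) = f"
  using inj by (rule inv_f_f)

definition coords :: "nat \<Rightarrow> (nat \<Rightarrow> complex) set" where
  "coords d = {f. \<forall>i\<ge>d. f i = 0}"

definition space :: "nat \<Rightarrow> 'u hilb" where
  "space d = \<lparr> carrier = e ` coords d, monoid.mult = undefined, one = undefined,
     ring.zero = e (\<lambda>i. 0), add = (\<lambda>x y. e (\<lambda>i. dec x i + dec y i)),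
     smult = (\<lambda>c x. e (\<lambda>i. c * dec x i)), ip = (\<lambda>x y. \<Sum>i<d. dec x i * cnj (dec y i)) \<rparr>"

lemma space_simps [simp]:
  "carrier (space d) = e ` coords d"
  "\<zero>\<^bsub>space d\<^esub> = e (\<lambda>i. 0)"
  "x \<oplus>\<^bsub>space d\<^esub> y = e (\<lambda>i. dec x i + dec y i)"
  "c \<odot>\<^bsub>space d\<^esub> x = e (\<lambda>i. c * dec x i)"
  "ip (space d) x y = (\<Sum>i<d. dec x i * cnj (dec y i))"
  by (simp_all add: space_def)

lemma coords_vanish: "f \<in> coords d \<Longrightarrow> d \<le> i \<Longrightarrow> f i = 0"
  by (simp add: coords_def)

lemma coords_eqI: "f \<in> coords d \<Longrightarrow> g \<in> coords d \<Longrightarrow> (\<And>i. i < d \<Longrightarrow> f i = g i) \<Longrightarrow> f = g"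
  by (rule ext) (metis coords_vanish not_less)

lemma abelian_group_space: "abelian_group (space d)"
proof (rule abelian_groupI)
  fix x assume "x \<in> carrier (space d)"
  then show "\<exists>y\<in>carrier (space d). y \<oplus>\<^bsub>space d\<^esub> x = \<zero>\<^bsub>space d\<^esub>"
    by (intro bexI[of _ "e (\<lambda>i. - dec x i)"]) (auto simp: coords_def)
qed (auto simp: coords_def algebra_simps intro!: imageI)

lemma a_minus_space:
  assumes "f \<in> coords d" "g \<in> coords d"
  shows "e f \<ominus>\<^bsub>space d\<^esub> e g = e (\<lambda>i. f i - g i)"
proof -
  have "\<ominus>\<^bsub>space d\<^esub> e g = e (\<lambda>i. - g i)"
    using assms by (intro abelian_group.minus_equality[OF abelian_group_space]) (auto simp: coords_def)
  then show ?thesis by (simp add: a_minus_def)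
qed

lemma hnorm_space: "hnorm (space d) x = sqrt (\<Sum>i<d. (cmod (dec x i))\<^sup>2)"
proof -
  have "Re (dec x i * cnj (dec x i)) = (cmod (dec x i))\<^sup>2" for i
    by (metis Re_complex_of_real complex_norm_square)
  then show ?thesis unfolding hnorm_def space_simps Re_sum by simp
qed

lemma hilbert_space: "complex_hilbert_space (space d)"
proof (intro complex_hilbert_space.intro complex_hilbert_space_axioms.intro)
  show "module (ring_of_type_algebra :: complex ring) (space d)"
    by (intro moduleI cring_from_type_algebra abelian_group_space)
      (auto simp: ring_of_type_algebra_def coords_def algebra_simps)
  show "x = \<zero>\<^bsub>space d\<^esub>" if x: "x \<in> carrier (space d)" "ip (space d) x x = 0" for x
  proof -
    obtain f where f: "f \<in> coords d" "x = e f" using x(1) by auto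
    have "complex_of_real (\<Sum>i<d. (cmod (f i))\<^sup>2) = 0"
      using x(2) unfolding of_real_sum complex_norm_square by (simp add: f)
    then have "(\<Sum>i<d. (cmod (f i))\<^sup>2) = 0" using of_real_eq_0_iff by blast
    then have "f i = 0" if "i < d" for i
      using that by (subst (asm) sum_nonneg_eq_0_iff) auto
    then have "f = (\<lambda>i. 0)" using f by (intro coords_eqI[of f d]) (auto simp: coords_def)
    then show ?thesis by (simp add: f)
  qed
  show "\<exists>x\<in>carrier (space d). (\<lambda>k. hnorm (space d) (s k \<ominus>\<^bsub>space d\<^esub> x)) \<longlonglongrightarrow> 0"
    if s: "range s \<subseteq> carrier (space d)"
      and cauchy: "\<forall>r>0. \<exists>N. \<forall>k\<ge>N. \<forall>l\<ge>N. hnorm (space d) (s k \<ominus>\<^bsub>space d\<^esub> s l) < r" for s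
  proof -
    define f where "f k = dec (s k)" for k
    have f: "f k \<in> coords d" "s k = e (f k)" for k
    proof -
      have "s k \<in> e ` coords d" using s by (auto simp: image_subset_iff)
      then show "f k \<in> coords d" "s k = e (f k)" by (auto simp: f_def)
    qed
    have "Cauchy (\<lambda>k. f k i)" if "i < d" for i
    proof (rule metric_CauchyI)
      fix r :: real assume "0 < r"
      then obtain N where N: "\<forall>k\<ge>N. \<forall>l\<ge>N. hnorm (space d) (s k \<ominus>\<^bsub>space d\<^esub> s l) < r"
        using cauchy by blast
      have "dist (f k i) (f l i) < r" if "k \<ge> N" "l \<ge> N" for k l
      proof -
        have "(cmod (f k i - f l i))\<^sup>2 \<le> (\<Sum>i<d. (cmod (f k i - f l i))\<^sup>2)"
          using \<open>i < d\<close> by (intro member_le_sum) auto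
        then have "cmod (f k i - f l i) \<le> sqrt (\<Sum>i<d. (cmod (f k i - f l i))\<^sup>2)"
          by (rule real_le_rsqrt)
        also have "\<dots> < r"
          using N that by (simp add: f a_minus_space hnorm_space)
        finally show ?thesis by (simp add: dist_norm)
      qed
      then show "\<exists>N. \<forall>k\<ge>N. \<forall>l\<ge>N. dist (f k i) (f l i) < r" by blast
    qed
    then have "\<forall>i. \<exists>z. i < d \<longrightarrow> (\<lambda>k. f k i) \<longlonglongrightarrow> z"
      using Cauchy_convergent_iff convergent_def by metis
    then obtain g' where g': "\<And>i. i < d \<Longrightarrow> (\<lambda>k. f k i) \<longlonglongrightarrow> g' i" by metis
    define g where "g i = (if i < d then g' i else 0)" for i
    have g: "g \<in> coords d" by (simp add: g_def coords_def)
    have "(\<lambda>k. sqrt (\<Sum>i<d. (cmod (f k i - g i))\<^sup>2)) \<longlonglongrightarrow> sqrt (\<Sum>i<d. (cmod (g i - g i))\<^sup>2)"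
      using g' by (intro tendsto_intros) (auto simp: g_def)
    then have "(\<lambda>k. hnorm (space d) (s k \<ominus>\<^bsub>space d\<^esub> e g)) \<longlonglongrightarrow> 0"
      using g by (simp add: f a_minus_space hnorm_space)
    then show ?thesis using g by auto
  qed
  show "0 \<le> Re (ip (space d) x x)" for x
    by (auto simp: Re_sum intro!: sum_nonneg)
qed (auto simp: algebra_simps sum.distrib sum_distrib_left)

lemma finsum_space:
  assumes "finite A" "F \<in> A \<rightarrow> carrier (space d)"
  shows "(\<Oplus>\<^bsub>space d\<^esub>a\<in>A. F a) = e (\<lambda>i. \<Sum>a\<in>A. dec (F a) i)"
proof -
  interpret abelian_group "space d" by (rule abelian_group_space)
  show ?thesis
    using assms by (induction A rule: finite_induct) (simp_all add: Pi_iff del: space_simps(1))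
qed

lemma finite_dimensional_space: "finite_dimensional (space d)"
proof -
  define \<delta> :: "nat \<Rightarrow> nat \<Rightarrow> complex" where "\<delta> j i = (if i = j then 1 else 0)" for i j
  have inj_\<delta>: "inj_on (\<lambda>j. e (\<delta> j)) {..<d}"
  proof (rule inj_onI)
    fix j k assume "e (\<delta> j) = e (\<delta> k)"
    then have "\<delta> j j = \<delta> k j" using dec_e by metis
    then show "j = k" by (auto simp: \<delta>_def split: if_splits)
  qed
  \<comment> \<open>Coefficients must be a function of the basis vector, not of its index; pairing x
    bilinearly with b recovers the coordinate.\<close>
  have "x = (\<Oplus>\<^bsub>space d\<^esub>b\<in>(\<lambda>j. e (\<delta> j)) ` {..<d}. (\<Sum>i<d. dec x i * dec b i) \<odot>\<^bsub>space d\<^esub> b)"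
    if x: "x \<in> carrier (space d)" for x
  proof -
    obtain f where f: "f \<in> coords d" "x = e f" using x by auto
    have "(\<Oplus>\<^bsub>space d\<^esub>b\<in>(\<lambda>j. e (\<delta> j)) ` {..<d}. (\<Sum>i<d. dec x i * dec b i) \<odot>\<^bsub>space d\<^esub> b) =
        e (\<lambda>i. \<Sum>j<d. f j * \<delta> j i)"
      using inj_\<delta>
      by (subst finsum_space) (auto simp: coords_def \<delta>_def[abs_def] sum.reindex f if_distrib[of "(*) _"] cong: if_cong)
    also have "(\<lambda>i. \<Sum>j<d. f j * \<delta> j i) = f"
      using f(1) by (intro ext) (auto simp: \<delta>_def coords_vanish if_distrib[of "(*) _"] cong: if_cong)
    finally show ?thesis by (simp add: f)
  qed
  then have "\<forall>x\<in>carrier (space d). \<exists>c. x = (\<Oplus>\<^bsub>space d\<^esub>b\<in>(\<lambda>j. e (\<delta> j)) ` {..<d}. c b \<odot>\<^bsub>space d\<^esub> b)"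
    by (intro ballI exI[of _ "\<lambda>b. \<Sum>i<d. dec _ i * dec b i"])
  moreover have "(\<lambda>j. e (\<delta> j)) ` {..<d} \<subseteq> carrier (space d)"
    by (auto simp: coords_def \<delta>_def)
  ultimately show ?thesis
    unfolding finite_dimensional_def by (meson finite_imageI finite_lessThan)
qed

section \<open>Real matrices as operators and their tensor products\<close>

definition mat_op :: "nat \<Rightarrow> (nat \<Rightarrow> nat \<Rightarrow> real) \<Rightarrow> 'u \<Rightarrow> 'u" where
  "mat_op d M x = e (\<lambda>i. if i < d then \<Sum>j<d. of_real (M i j) * dec x j else 0)"

lemma linear_mat_op: "linear_op (space d) (mat_op d M)"
  by (auto simp: linear_op_def mat_op_def coords_def algebra_simps sum.distrib sum_distrib_left
      intro!: arg_cong[of _ _ e])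

lemma projection_mat_op:
  assumes sym: "\<And>k l. M k l = M l k"
    and idem: "\<And>k l. k < d \<Longrightarrow> l < d \<Longrightarrow> (\<Sum>j<d. M k j * M j l) = M k l"
  shows "projection (space d) (mat_op d M)"
  unfolding projection_def
proof (intro conjI ballI linear_mat_op)
  show "mat_op d M (mat_op d M x) = mat_op d M x" for x
  proof -
    have "(\<Sum>j<d. of_real (M i j) * (\<Sum>l<d. of_real (M j l) * dec x l)) =
        (\<Sum>l<d. of_real (M i l) * dec x l)" if "i < d" for i
    proof -
      have "(\<Sum>j<d. of_real (M i j) * (\<Sum>l<d. of_real (M j l) * dec x l)) =
          (\<Sum>l<d. of_real (\<Sum>j<d. M i j * M j l) * dec x l)"
        unfolding sum_distrib_left of_real_sum sum_distrib_right
        by (subst sum.swap) (simp add: mult.assoc)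
      then show ?thesis using idem that by simp
    qed
    then show ?thesis by (auto simp: mat_op_def intro!: arg_cong[of _ _ e])
  qed
  show "ip (space d) (mat_op d M x) y = ip (space d) x (mat_op d M y)" for x y
  proof -
    have "ip (space d) (mat_op d M x) y = (\<Sum>i<d. \<Sum>j<d. of_real (M i j) * dec x j * cnj (dec y i))"
      by (simp add: mat_op_def sum_distrib_right)
    also have "\<dots> = (\<Sum>j<d. \<Sum>i<d. of_real (M j i) * dec x j * cnj (dec y i))"
      by (subst sum.swap) (simp add: sym)
    also have "\<dots> = ip (space d) x (mat_op d M y)"
      by (simp add: mat_op_def sum_distrib_left mult_ac)
    finally show ?thesis .
  qed
qed

lemma pvm_mat_op:
  fixes M :: "'o::finite \<Rightarrow> nat \<Rightarrow> nat \<Rightarrow> real"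
  assumes sym: "\<And>i k l. M i k l = M i l k"
    and idem: "\<And>i k l. k < d \<Longrightarrow> l < d \<Longrightarrow> (\<Sum>j<d. M i k j * M i j l) = M i k l"
    and total: "\<And>k l. k < d \<Longrightarrow> l < d \<Longrightarrow> (\<Sum>i\<in>UNIV. M i k l) = (if k = l then 1 else 0)"
  shows "pvm (space d) (\<lambda>i. mat_op d (M i))"
  unfolding pvm_def
proof (intro conjI allI ballI projection_mat_op sym idem)
  fix x assume "x \<in> carrier (space d)"
  then obtain f where f: "f \<in> coords d" "x = e f" by auto
  have "(\<Sum>i\<in>UNIV. \<Sum>j<d. of_real (M i k j) * f j) = f k" if "k < d" for k
  proof -
    have "(\<Sum>i\<in>UNIV. \<Sum>j<d. of_real (M i k j) * f j) = (\<Sum>j<d. of_real (\<Sum>i\<in>UNIV. M i k j) * f j)"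
      unfolding of_real_sum sum_distrib_right by (rule sum.swap)
    also have "\<dots> = (\<Sum>j<d. if k = j then f j else 0)"
      using that by (intro sum.cong) (auto simp: total)
    finally show ?thesis using that by simp
  qed
  then have "(\<Sum>i\<in>UNIV. dec (mat_op d (M i) x) k) = f k" for k
    using f(1) by (cases "k < d") (simp_all add: mat_op_def f(2) coords_vanish)
  then show "(\<Oplus>\<^bsub>space d\<^esub>i\<in>UNIV. mat_op d (M i) x) = x"
    using f by (subst finsum_space) (auto simp: mat_op_def coords_def)
qed auto

definition kron :: "nat \<Rightarrow> 'u \<Rightarrow> 'u \<Rightarrow> 'u" where
  "kron d a b = e (\<lambda>n. if n < d * d then dec a (n div d) * dec b (n mod d) else 0)"

lemma div_mod_less: "n < d * d \<Longrightarrow> n div d < d \<and> n mod d < (d::nat)"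
  by (cases "d = 0") (auto simp: less_mult_imp_div_less)

lemma div_mod_eq_iff: "n div d = k div d \<and> n mod d = k mod d \<longleftrightarrow> n = (k::nat)"
  by (metis div_mult_mod_eq)

lemma tensor_product_kron: "tensor_product (space d) (space d) (space (d * d)) (kron d)"
  unfolding tensor_product_def
proof (intro conjI ballI allI)
  show "ip (space (d * d)) (kron d a b) (kron d a' b') = ip (space d) a a' * ip (space d) b b'"
    for a a' b b'
    using sum_div_mod[of "\<lambda>i j. dec a i * dec b j * (cnj (dec a' i) * cnj (dec b' j))" d]
    by (simp add: kron_def sum_product mult_ac)
  show "\<exists>(r::nat) a b. (\<forall>k<r. a k \<in> carrier (space d) \<and> b k \<in> carrier (space d)) \<and>
      z = (\<Oplus>\<^bsub>space (d * d)\<^esub>k\<in>{..<r}. kron d (a k) (b k))"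
    if z: "z \<in> carrier (space (d * d))" for z
  proof -
    obtain f where f: "f \<in> coords (d * d)" "z = e f" using z by auto
    \<comment> \<open>The k-th summand is f(k) times the unit vector at k div d, tensored with the
      unit vector at k mod d.\<close>
    define a where "a k = e (\<lambda>i. if i < d \<and> i = k div d then f k else 0)" for k
    define b where "b k = e (\<lambda>i. if i < d \<and> i = k mod d then 1 else 0)" for k
    have "(\<Sum>k<d * d. dec (kron d (a k) (b k)) n) = f n" for n
    proof (cases "n < d * d")
      case True
      then have "(\<Sum>k<d * d. dec (kron d (a k) (b k)) n) = (\<Sum>k<d * d. if k = n then f k else 0)"
        using div_mod_less[OF True] div_mod_eq_iff[of n d, THEN iffD1]
        by (intro sum.cong) (auto simp: kron_def a_def b_def)
      then show ?thesis using True by simp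
    qed (use f in \<open>simp add: kron_def coords_vanish\<close>)
    then have "z = (\<Oplus>\<^bsub>space (d * d)\<^esub>k\<in>{..<d * d}. kron d (a k) (b k))"
      using f by (subst finsum_space) (auto simp: kron_def coords_def)
    moreover have "\<forall>k<d * d. a k \<in> carrier (space d) \<and> b k \<in> carrier (space d)"
      by (auto simp: a_def b_def coords_def)
    ultimately show ?thesis by blast
  qed
qed (auto simp: hilbert_space kron_def coords_def algebra_simps intro!: imageI arg_cong[of _ _ e])

definition kron_mat :: "nat \<Rightarrow> (nat \<Rightarrow> nat \<Rightarrow> real) \<Rightarrow> (nat \<Rightarrow> nat \<Rightarrow> real) \<Rightarrow> nat \<Rightarrow> nat \<Rightarrow> real" where
  "kron_mat d M N n k = M (n div d) (k div d) * N (n mod d) (k mod d)"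

lemma is_tensor_op_kron:
  "is_tensor_op (space d) (space d) (space (d * d)) (kron d)
    (mat_op d M) (mat_op d N) (mat_op (d * d) (kron_mat d M N))"
  unfolding is_tensor_op_def
proof (intro conjI ballI linear_mat_op)
  show "mat_op (d * d) (kron_mat d M N) (kron d a b) = kron d (mat_op d M a) (mat_op d N b)" for a b
  proof -
    have "(\<Sum>k<d * d. of_real (kron_mat d M N n k) * dec (kron d a b) k) =
        (\<Sum>j<d. of_real (M (n div d) j) * dec a j) * (\<Sum>j<d. of_real (N (n mod d) j) * dec b j)" for n
      using sum_div_mod[of "\<lambda>i j. of_real (M (n div d) i) * of_real (N (n mod d) j) * (dec a i * dec b j)" d]
      by (simp add: kron_mat_def kron_def sum_product mult_ac)
    moreover have "(if n < d * d then (\<Sum>j<d. of_real (M (n div d) j) * dec a j) *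
          (\<Sum>j<d. of_real (N (n mod d) j) * dec b j) else 0) =
        (if n < d * d then dec (mat_op d M a) (n div d) * dec (mat_op d N b) (n mod d) else 0)" for n
      using div_mod_less[of n d] by (simp add: mat_op_def)
    ultimately show ?thesis
      unfolding mat_op_def[of "d * d"] kron_def[of d "mat_op d M a"] by presburger
  qed
qed

text \<open>Both parties use the same real symmetric matrices in the state sum_k r_k e_k (x) e_k.
  Expectation in it turns a tensor product of matrices into their entrywise product.\<close>

lemma C_q_intro:
  fixes M :: "'i::finite \<Rightarrow> 'o::finite \<Rightarrow> nat \<Rightarrow> nat \<Rightarrow> real" and p :: "('i, 'o) corr"
  assumes sym: "\<And>v i k l. M v i k l = M v i l k"
    and idem: "\<And>v i k l. k < d \<Longrightarrow> l < d \<Longrightarrow> (\<Sum>j<d. M v i k j * M v i j l) = M v i k l"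
    and total: "\<And>v k l. k < d \<Longrightarrow> l < d \<Longrightarrow> (\<Sum>i\<in>UNIV. M v i k l) = (if k = l then 1 else 0)"
    and r: "(\<Sum>k<d. (r k)\<^sup>2) = 1"
    and corr: "correlation p"
    and p: "\<And>i j v w. p $ (i, j, v, w) = (\<Sum>k<d. \<Sum>l<d. M v i k l * M w j k l * r k * r l)"
  shows "p \<in> C_q (U :: 'u itself)"
proof -
  define P where "P v i = mat_op d (M v i)" for v i
  define h where "h = e (\<lambda>n. if n < d * d \<and> n div d = n mod d then of_real (r (n div d)) else 0)"
  have pvm: "pvm (space d) (P v)" for v
    unfolding P_def by (rule pvm_mat_op[OF sym idem total])
  have "(\<Sum>n<d * d. (cmod (dec h n))\<^sup>2) = (\<Sum>n<d * d. if n div d = n mod d then (r (n div d))\<^sup>2 else 0)"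
    by (intro sum.cong) (auto simp: h_def)
  also have "\<dots> = (\<Sum>k<d. \<Sum>l<d. if k = l then (r k)\<^sup>2 else 0)"
    by (rule sum_div_mod)
  also have "\<dots> = 1" using r by simp
  finally have unit: "unit_vector (space (d * d)) h"
    by (auto simp: unit_vector_def hnorm_space h_def coords_def)
  have val: "complex_of_real (p $ (i, j, v, w)) =
      ip (space (d * d)) (mat_op (d * d) (kron_mat d (M v i) (M w j)) h) h" for i j v w
  proof -
    have row: "(\<Sum>n<d * d. of_real (kron_mat d (M v i) (M w j) k n) * dec h n) =
        complex_of_real (\<Sum>l<d. M v i (k div d) l * M w j (k mod d) l * r l)" for k
    proof -
      have "(\<Sum>n<d * d. of_real (kron_mat d (M v i) (M w j) k n) * dec h n) =
          (\<Sum>n<d * d. of_real (M v i (k div d) (n div d) * M w j (k mod d) (n mod d) *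
            (if n div d = n mod d then r (n div d) else 0)))"
        by (intro sum.cong) (auto simp: h_def kron_mat_def)
      also have "\<dots> = (\<Sum>l<d. \<Sum>l'<d. complex_of_real (M v i (k div d) l * M w j (k mod d) l' *
            (if l = l' then r l else 0)))"
        by (rule sum_div_mod)
      also have "\<dots> = complex_of_real (\<Sum>l<d. M v i (k div d) l * M w j (k mod d) l * r l)"
        by (simp add: if_distrib[of "\<lambda>x. _ * x"] if_distrib[of complex_of_real] cong: if_cong)
      finally show ?thesis .
    qed
    have "ip (space (d * d)) (mat_op (d * d) (kron_mat d (M v i) (M w j)) h) h =
        (\<Sum>n<d * d. complex_of_real ((\<Sum>l<d. M v i (n div d) l * M w j (n mod d) l * r l) *
            (if n div d = n mod d then r (n div d) else 0)))"
      unfolding space_simps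
      by (intro sum.cong refl) (auto simp: mat_op_def row, auto simp: h_def)
    also have "\<dots> = (\<Sum>k<d. \<Sum>k'<d. complex_of_real ((\<Sum>l<d. M v i k l * M w j k' l * r l) *
            (if k = k' then r k else 0)))"
      by (rule sum_div_mod)
    also have "\<dots> = complex_of_real (\<Sum>k<d. (\<Sum>l<d. M v i k l * M w j k l * r l) * r k)"
      by (simp add: if_distrib[of "\<lambda>x. _ * x"] if_distrib[of complex_of_real] cong: if_cong)
    finally show ?thesis by (simp add: p sum_distrib_right sum_distrib_left mult_ac)
  qed
  have "\<exists>R. is_tensor_op (space d) (space d) (space (d * d)) (kron d) (P v i) (P w j) R \<and>
        complex_of_real (p $ (i, j, v, w)) = ip (space (d * d)) (R h) h" for i j v w
    unfolding P_def using is_tensor_op_kron val by blast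
  then show ?thesis
    unfolding C_q_def mem_Collect_eq
    using corr hilbert_space finite_dimensional_space tensor_product_kron pvm unit by blast
qed

lemma C_vect_intro:
  fixes x :: "'i::finite \<Rightarrow> 'o::finite \<Rightarrow> nat \<Rightarrow> real" and p :: "('i, 'o) corr"
  assumes h: "(\<Sum>k<d. (h k)\<^sup>2) = 1"
    and orth: "\<And>v i j. i \<noteq> j \<Longrightarrow> (\<Sum>k<d. x v i k * x v j k) = 0"
    and total: "\<And>v k. k < d \<Longrightarrow> (\<Sum>i\<in>UNIV. x v i k) = h k"
    and corr: "correlation p"
    and p: "\<And>i j v w. p $ (i, j, v, w) = (\<Sum>k<d. x v i k * x w j k)"
  shows "p \<in> C_vect (U :: 'u itself)"
proof -
  define E where "E f = e (\<lambda>k. if k < d then complex_of_real (f k) else 0)" for f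
  have E: "E f \<in> carrier (space d)" for f by (auto simp: E_def coords_def)
  have ip: "ip (space d) (E f) (E g) = complex_of_real (\<Sum>k<d. f k * g k)" for f g
    by (simp add: E_def)
  have "(\<Oplus>\<^bsub>space d\<^esub>i\<in>UNIV. E (x v i)) = E h" for v
  proof -
    have "(\<Oplus>\<^bsub>space d\<^esub>i\<in>UNIV. E (x v i)) = e (\<lambda>k. \<Sum>i\<in>UNIV. dec (E (x v i)) k)"
      using E by (intro finsum_space) auto
    also have "(\<lambda>k. \<Sum>i\<in>UNIV. dec (E (x v i)) k) = (\<lambda>k. if k < d then complex_of_real (h k) else 0)"
      using total by (auto simp: E_def simp flip: of_real_sum)
    finally show ?thesis by (simp add: E_def)
  qed
  moreover have "unit_vector (space d) (E h)"
    using h E ip[of h h] by (simp add: unit_vector_def hnorm_def power2_eq_square del: space_simps)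
  moreover have "0 \<le> p $ (i, j, v, w)" for i j v w
    using corr by (simp add: correlation_def)
  ultimately show ?thesis
    unfolding C_vect_def
    using corr hilbert_space[of d] E orth
    by (intro CollectI conjI exI[of _ "space d"] exI[of _ "\<lambda>v i. E (x v i)"] exI[of _ "E h"])
      (auto simp: ip p simp del: space_simps)
qed

end


section \<open>Explicit models\<close>

lemma two_cases: "i = 0 \<or> i = 1" for i :: 2
  using UNIV_two by blast

text \<open>As in the Schur product theorem: a real symmetric idempotent is a matrix times its
  transpose, which makes the form a sum of squares. This provides the nonnegativity of the
  correlations built from matrices.\<close>

lemma hadamard_quadratic_nonneg:
  fixes M N :: "nat \<Rightarrow> nat \<Rightarrow> real"
  assumes M: "\<And>k l. M k l = M l k" "\<And>k l. k < d \<Longrightarrow> l < d \<Longrightarrow> (\<Sum>j<d. M k j * M j l) = M k l"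
    and N: "\<And>k l. N k l = N l k" "\<And>k l. k < d \<Longrightarrow> l < d \<Longrightarrow> (\<Sum>j<d. N k j * N j l) = N k l"
  shows "0 \<le> (\<Sum>k<d. \<Sum>l<d. M k l * N k l * r k * r l)"
proof -
  let ?S = "{..<d} \<times> {..<d}"
  have "(\<Sum>k<d. \<Sum>l<d. M k l * N k l * r k * r l) =
      (\<Sum>(k, l)\<in>?S. \<Sum>(i, j)\<in>?S. (M k i * M i l) * (N k j * N j l) * r k * r l)"
    by (auto simp: sum.cartesian_product[symmetric] sum_product[symmetric] M(2) N(2)
        sum_distrib_right[symmetric] intro!: sum.cong)
  also have "\<dots> = (\<Sum>(i, j)\<in>?S. \<Sum>(k, l)\<in>?S. (M k i * M i l) * (N k j * N j l) * r k * r l)"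
    unfolding case_prod_unfold by (rule sum.swap)
  also have "\<dots> = (\<Sum>(i, j)\<in>?S. (\<Sum>k<d. M k i * N k j * r k)\<^sup>2)"
    by (intro sum.cong)
      (auto simp: sum.cartesian_product[symmetric] power2_eq_square sum_product M(1) N(1) mult_ac
        intro!: sum.cong)
  also have "\<dots> \<ge> 0" by (intro sum_nonneg) auto
  finally show ?thesis .
qed

lemma correlation_matrix_model:
  fixes M :: "'i::finite \<Rightarrow> 'o::finite \<Rightarrow> nat \<Rightarrow> nat \<Rightarrow> real" and p :: "('i, 'o) corr"
  assumes sym: "\<And>v i k l. M v i k l = M v i l k"
    and idem: "\<And>v i k l. k < d \<Longrightarrow> l < d \<Longrightarrow> (\<Sum>j<d. M v i k j * M v i j l) = M v i k l"
    and total: "\<And>v k l. k < d \<Longrightarrow> l < d \<Longrightarrow> (\<Sum>i\<in>UNIV. M v i k l) = (if k = l then 1 else 0)"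
    and r: "(\<Sum>k<d. (r k)\<^sup>2) = 1"
    and p: "\<And>i j v w. p $ (i, j, v, w) = (\<Sum>k<d. \<Sum>l<d. M v i k l * M w j k l * r k * r l)"
  shows "correlation p"
  unfolding correlation_def
proof (intro conjI allI)
  show "0 \<le> p $ (i, j, v, w)" for i j v w
    unfolding p by (rule hadamard_quadratic_nonneg) (use sym idem in auto)
  show "(\<Sum>i\<in>UNIV. \<Sum>j\<in>UNIV. p $ (i, j, v, w)) = 1" for v w
  proof -
    have "(\<Sum>i\<in>UNIV. \<Sum>j\<in>UNIV. p $ (i, j, v, w)) =
        (\<Sum>i\<in>UNIV. \<Sum>k<d. \<Sum>l<d. \<Sum>j\<in>UNIV. M v i k l * M w j k l * r k * r l)"
      unfolding p by (subst sum.swap, subst (2) sum.swap) (rule refl)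
    also have "\<dots> = (\<Sum>k<d. \<Sum>l<d. \<Sum>i\<in>UNIV. \<Sum>j\<in>UNIV. M v i k l * M w j k l * r k * r l)"
      by (subst sum.swap, subst (2) sum.swap) (rule refl)
    also have "\<dots> = (\<Sum>k<d. \<Sum>l<d. (\<Sum>i\<in>UNIV. M v i k l) * (\<Sum>j\<in>UNIV. M w j k l) * r k * r l)"
      by (simp add: sum_product flip: sum_distrib_right)
    also have "\<dots> = (\<Sum>k<d. \<Sum>l<d. if k = l then (r k)\<^sup>2 else 0)"
      by (intro sum.cong refl) (auto simp: total power2_eq_square)
    finally show ?thesis using r by simp
  qed
qed

lemma closure_C_qc_sync_correlation:
  "p \<in> closure (C_qc (U :: 'u itself)) \<Longrightarrow> synchronous p \<Longrightarrow> sync_correlation p"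
  by (simp add: sync_correlation_def closure_C_qc_correlation)

text \<open>
  Three lines at angles \<open>0\<close>, \<open>\<pi> / 3\<close> and \<open>2 * \<pi> / 3\<close>.  In \<open>block_proj\<close> the coordinates 0 to 3
  carry four deterministic strategies, and 4, 5 the projections onto the lines.
\<close>

definition line :: "3 \<Rightarrow> real \<times> real" where
  "line v = (if v = 0 then (1, 0) else if v = 1 then (1 / 2, sqrt 3 / 2) else (- 1 / 2, sqrt 3 / 2))"

definition block_proj :: "3 \<Rightarrow> nat \<Rightarrow> nat \<Rightarrow> real" where
  "block_proj v k l =
    (if k = 4 \<or> k = 5 then
       (if l = 4 \<or> l = 5 then
          (if k = 4 then fst (line v) else snd (line v)) * (if l = 4 then fst (line v) else snd (line v))
        else 0)
     else if k = l \<and> (k = 0 \<or> k = 2 \<and> v = 0 \<or> k = 3 \<and> v \<noteq> 0) then 1 else 0)"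

definition block_pvm :: "3 \<Rightarrow> 2 \<Rightarrow> nat \<Rightarrow> nat \<Rightarrow> real" where
  "block_pvm v i k l = (if i = 0 then block_proj v k l else of_bool (k = l) - block_proj v k l)"

lemma line_unit: "fst (line v) * fst (line v) + snd (line v) * snd (line v) = 1"
  by (simp add: line_def)

lemma lessThan_six: "{..<6::nat} = {0, 1, 2, 3, 4, 5}"
  by auto

lemma block_proj_sym: "block_proj v k l = block_proj v l k"
  by (auto simp: block_proj_def)

lemma block_proj_idem:
  assumes "k < 6" "l < 6"
  shows "(\<Sum>j<6. block_proj v k j * block_proj v j l) = block_proj v k l"
proof -
  have "x * fst (line v) * (fst (line v) * y) + x * snd (line v) * (snd (line v) * y) = x * y" for x y
    using arg_cong[OF line_unit[of v], of "\<lambda>z. x * y * z"] by (simp add: algebra_simps)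
  moreover have "k \<in> {0, 1, 2, 3, 4, 5}" "l \<in> {0, 1, 2, 3, 4, 5}"
    using assms by auto
  ultimately show ?thesis
    unfolding lessThan_six by (auto simp: block_proj_def)
qed

lemma block_pvm_idem:
  assumes "k < 6" "l < 6"
  shows "(\<Sum>j<6. block_pvm v i k j * block_pvm v i j l) = block_pvm v i k l"
proof (cases "i = 0")
  case False
  have "(\<Sum>j<6. (of_bool (k = j) - block_proj v k j) * (of_bool (j = l) - block_proj v j l)) =
      (\<Sum>j<6. (if j = k then of_bool (k = l) - block_proj v k l else 0) -
        (if j = l then block_proj v k l else 0) + block_proj v k j * block_proj v j l)"
    by (intro sum.cong) (auto simp: algebra_simps)
  also have "\<dots> = of_bool (k = l) - block_proj v k l"
    using assms by (simp add: sum.distrib sum_subtractf block_proj_idem)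
  finally show ?thesis using False by (simp add: block_pvm_def)
qed (use assms in \<open>simp add: block_pvm_def block_proj_idem\<close>)

context universe
begin

text \<open>The numbers l0 to l4 are the weights in a convex combination of the five extreme points:
  always answer 0; always answer 1; answer 0 on input 0 only; answer 0 on inputs 1 and 2 only;
  measure along the three lines.\<close>

lemma Theta_tq_intro:
  assumes l: "0 \<le> l0" "0 \<le> l1" "0 \<le> l2" "0 \<le> l3" "0 \<le> l4" "l0 + l1 + l2 + l3 + l4 = 1"
    and \<theta>: "6 * \<theta> = 6 * l0 + 2 * l2 + 4 * l3 + 3 * l4" and s: "24 * s = 12 + 8 * l2 + 8 * l3 + 9 * l4"
  shows "(\<theta>, s) \<in> Theta (U :: 'u itself) tq"
proof -
  \<comment> \<open>Squared amplitudes are the weights; that of the plane is divided equally, giving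
    a maximally entangled component.\<close>
  define r where "r k = sqrt ([l0, l1, l2, l3, l4 / 2, l4 / 2] ! k)" for k
  define p :: "(3, 2) corr" where
    "p = (\<chi> x. case x of (i, j, v, w) \<Rightarrow>
      \<Sum>k<6. \<Sum>l<6. block_pvm v i k l * block_pvm w j k l * r k * r l)"
  have p: "p $ (i, j, v, w) = (\<Sum>k<6. \<Sum>l<6. block_pvm v i k l * block_pvm w j k l * r k * r l)"
    for i j v w by (simp add: p_def)
  have sym: "block_pvm v i k l = block_pvm v i l k" for v i k l
    by (auto simp: block_pvm_def block_proj_sym)
  have total: "(\<Sum>i\<in>UNIV. block_pvm v i k l) = (if k = l then 1 else 0)" for v k l
    by (simp add: sum_two block_pvm_def)
  have r2: "(\<Sum>k<6. (r k)\<^sup>2) = 1"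
    using l by (simp add: lessThan_six r_def)
  have corr: "correlation p"
    by (rule correlation_matrix_model[OF sym block_pvm_idem total r2 p])
  have C_q: "p \<in> C_q U"
    by (rule C_q_intro[OF sym block_pvm_idem total r2 corr p])
  have both: "p $ (0, 0, v, w) = l0 + of_bool (v = 0 \<and> w = 0) * l2 + of_bool (v \<noteq> 0 \<and> w \<noteq> 0) * l3 +
      (fst (line v) * fst (line w) + snd (line v) * snd (line w))\<^sup>2 * l4 / 2" for v w
  proof -
    have "p $ (0, 0, v, w) = (\<Sum>k<6. \<Sum>l<6. block_proj v k l * block_proj w k l * r k * r l)"
      by (simp add: p block_pvm_def)
    also have "\<dots> = l0 + of_bool (v = 0 \<and> w = 0) * l2 + of_bool (v \<noteq> 0 \<and> w \<noteq> 0) * l3 +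
      (fst (line v) * fst (line w) + snd (line v) * snd (line w))\<^sup>2 * l4 / 2"
      using l by (auto simp: lessThan_six block_proj_def r_def power2_eq_square algebra_simps add_divide_distrib)
    finally show ?thesis .
  qed
  \<comment> \<open>Synchronicity comes from here: r is constant on the plane, the only block that
    is not diagonal, so idempotence collapses the double sum.\<close>
  have diag: "p $ (0, 0, v, v) = (\<Sum>k<6. block_proj v k k * r k * r k)" for v
  proof -
    have "l4 * (fst (line v) * fst (line v)) + l4 * (snd (line v) * snd (line v)) = l4"
      by (simp add: line_unit flip: distrib_left)
    then show ?thesis
      using l by (auto simp: both line_unit lessThan_six block_proj_def r_def algebra_simps add_divide_distrib)
  qed
  have "p $ (0, 1, v, v) = 0" "p $ (1, 0, v, v) = 0" for v
  proof -
    have "p $ (0, 1, v, v) = (\<Sum>k<6. \<Sum>l<6. (if k = l then block_proj v k k * r k * r k else 0) -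
        block_proj v k l * block_proj v k l * r k * r l)"
      unfolding p by (intro sum.cong refl) (auto simp: block_pvm_def algebra_simps)
    also have "\<dots> = (\<Sum>k<6. block_proj v k k * r k * r k) - p $ (0, 0, v, v)"
      by (simp add: sum_subtractf p block_pvm_def)
    finally show "p $ (0, 1, v, v) = 0" using diag by simp
    moreover have "p $ (1, 0, v, v) = p $ (0, 1, v, v)"
      unfolding p by (intro sum.cong refl) (simp add: mult_ac)
    ultimately show "p $ (1, 0, v, v) = 0" by simp
  qed
  note off_diag = this
  have sync: "synchronous p"
    unfolding synchronous_def
  proof (intro allI impI)
    show "p $ (i, j, v, v) = 0" if "i \<noteq> j" for v i j
      using that two_cases[of i] two_cases[of j] off_diag by auto
  qed
  then have "p \<in> C_sync U tq" using C_q by (simp add: C_sync_def)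
  moreover interpret sync_correlation p
    using C_q C_q_subset_C_qc closure_subset sync
    by (intro closure_C_qc_sync_correlation[where U = U]) blast+
  have "3 * theta p = 3 * \<theta>"
    unfolding theta_eq using \<theta> by (simp add: both line_def power2_eq_square)
  then have "theta p = \<theta>" by simp
  moreover have "overlap 0 = 3 * l0 + l3 + 3 * l4 / 8"
    by (simp add: overlap_def both line_def power2_eq_square)
  ultimately show ?thesis
    unfolding Theta_def image_iff
    using s \<theta> by (intro bexI[of _ p]) (simp_all add: theta_tilde_eq add_divide_distrib)
qed

text \<open>All marginals are \<theta> and all overlaps c. Three conditions are nonnegativity of the
  entries of p; the last says that the Gram matrix of the components orthogonal to h is positive
  along (1, 1, 1).\<close>

lemma Theta_tvect_intro:
  fixes \<theta> c :: real
  assumes c: "0 \<le> c" "2 * \<theta> - 1 \<le> c" "c \<le> \<theta>" "3 * \<theta>\<^sup>2 \<le> \<theta> + 2 * c"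
  shows "(\<theta>, 1 / 2 + \<theta> - c) \<in> Theta (U :: 'u itself) tvect"
proof -
  \<comment> \<open>That Gram matrix has diagonal \<theta> - \<theta>^2, off-diagonal c -
    \<theta>^2, and eigenvalues \<theta> - c (twice) and \<theta> + 2 c - 3 \<theta>^2. Its square
    root is \<beta> times the identity plus \<gamma> times the all-ones matrix.\<close>
  define \<beta> where "\<beta> = sqrt (\<theta> - c)"
  define \<gamma> where "\<gamma> = (sqrt (\<theta> + 2 * c - 3 * \<theta>\<^sup>2) - \<beta>) / 3"
  have \<beta>: "\<beta> * \<beta> = \<theta> - c" using c by (simp add: \<beta>_def)
  have "(\<beta> + 3 * \<gamma>) * (\<beta> + 3 * \<gamma>) = \<theta> + 2 * c - 3 * \<theta>\<^sup>2"
    using c by (simp add: \<gamma>_def)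
  then have \<gamma>: "2 * (\<beta> * \<gamma>) + 3 * (\<gamma> * \<gamma>) = c - \<theta> * \<theta>"
    using \<beta> by (simp add: algebra_simps power2_eq_square)
  define h :: "nat \<Rightarrow> real" where "h k = of_bool (k = 3)" for k
  \<comment> \<open>Coordinate 3 carries h and has to be tested first, since \<open>of_nat 3\<close>
    is 0 in type \<open>3\<close>.\<close>
  define x0 :: "3 \<Rightarrow> nat \<Rightarrow> real" where
    "x0 v k = (if k = 3 then \<theta> else \<gamma> + \<beta> * of_bool (of_nat k = v))" for v k
  define x where "x v i k = (if i = 0 then x0 v k else h k - x0 v k)" for v and i :: 2 and k
  define g where "g v w = (if v = w then \<theta> else c)" for v w :: 3
  define p :: "(3, 2) corr" where "p = (\<chi> y. case y of (i, j, v, w) \<Rightarrow>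
    if i = 0 then if j = 0 then g v w else \<theta> - g v w
    else if j = 0 then \<theta> - g v w else 1 - 2 * \<theta> + g v w)"
  have four: "{..<4::nat} = {0, 1, 2, 3}" by auto
  have three: "v = 0 \<or> v = 1 \<or> v = 2" for v :: 3 using UNIV_three by blast
  have gram: "(\<Sum>k<4. x0 v k * x0 w k) = g v w" for v w
    using three[of v] three[of w] \<beta> \<gamma>
    by (elim disjE) (simp_all add: four x0_def g_def algebra_simps)
  have hx: "(\<Sum>k<4. h k * x0 v k) = \<theta>" "(\<Sum>k<4. x0 v k * h k) = \<theta>" "(\<Sum>k<4. h k * h k) = 1" for v
    by (simp_all add: four x0_def h_def)
  have p: "p $ (i, j, v, w) = (\<Sum>k<4. x v i k * x w j k)" for i j v w
    by (auto simp: p_def x_def algebra_simps sum.distrib sum_subtractf gram hx)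
  have corr: "correlation p"
    unfolding correlation_def using c by (auto simp: p_def g_def sum_two)
  have "p \<in> C_vect U"
  proof (rule C_vect_intro[where d = 4 and h = h and x = x])
    show "(\<Sum>k<4. (h k)\<^sup>2) = 1" using hx(3) by (simp add: power2_eq_square)
    show "(\<Sum>k<4. x v i k * x v j k) = 0" if "i \<noteq> j" for v i j
      unfolding p[symmetric] using that UNIV_two by (auto simp: p_def g_def)
    show "(\<Sum>i\<in>UNIV. x v i k) = h k" for v k by (simp add: sum_two x_def)
  qed (rule corr p)+
  moreover have "synchronous p"
    unfolding synchronous_def
  proof (intro allI impI)
    show "p $ (i, j, v, v) = 0" if "i \<noteq> j" for v i j
      using that two_cases[of i] two_cases[of j] by (auto simp: p_def g_def)
  qed
  ultimately have mem: "p \<in> C_sync U tvect" "synchronous p" "no_signalling p"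
    by (auto simp: C_sync_def C_vect_no_signalling)
  have p00: "p $ (0, 0, v, w) = g v w" for v w by (simp add: p_def)
  interpret sync_correlation p by (unfold_locales) (rule corr mem)+
  have "theta p = \<theta>" "overlap 0 = 3 * c"
    using theta_eq by (simp_all add: p00 g_def overlap_def)
  then show ?thesis
    using mem(1) unfolding Theta_def image_iff
    by (intro bexI[of _ p]) (simp_all add: theta_tilde_eq)
qed

end

text \<open>A minimum in place of a case distinction: membership in the region splits into separate
  bounds, and continuity is immediate.\<close>

definition upper_q :: "real \<Rightarrow> real" where
  "upper_q \<theta> = min (min (1 / 2 + \<theta>) ((3 + \<theta>) / 4)) (min ((4 - \<theta>) / 4) (3 / 2 - \<theta>))"

definition upper_vect :: "real \<Rightarrow> real" where
  "upper_vect \<theta> = min (1 / 2 + \<theta>) (min ((1 + 3 * \<theta> - 3 * \<theta>\<^sup>2) / 2) (3 / 2 - \<theta>))"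

definition region :: "(real \<Rightarrow> real) \<Rightarrow> (real \<times> real) set" where
  "region F = {x. 0 \<le> fst x \<and> fst x \<le> 1 \<and> 1 / 2 \<le> snd x \<and> snd x \<le> F (fst x)}"

lemma closed_region:
  assumes "continuous_on UNIV F" shows "closed (region F)"
proof -
  have "continuous_on UNIV (\<lambda>x :: real \<times> real. F (fst x))"
    by (rule continuous_on_compose2[OF assms]) (auto intro: continuous_intros)
  then show ?thesis
    unfolding region_def by (intro closed_Collect_conj closed_Collect_le continuous_intros)
qed

lemma f_upper_lower_region:
  assumes "Theta U t = region F" "0 \<le> \<theta>" "\<theta> \<le> 1" "1 / 2 \<le> F \<theta>"
  shows "f_upper U t \<theta> = F \<theta>" "f_lower U t \<theta> = 1 / 2"
proof -
  have "{s. (\<theta>, s) \<in> Theta U t} = {1 / 2..F \<theta>}"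
    using assms by (auto simp: region_def)
  then show "f_upper U t \<theta> = F \<theta>" "f_lower U t \<theta> = 1 / 2"
    using assms(4) by (simp_all add: f_upper_def f_lower_def)
qed

lemma Theta_tq_subset_tqa: "Theta U tq \<subseteq> Theta U tqa"
  using closure_subset by (fastforce simp: Theta_def C_sync_def C_qa_def)

lemma Theta_closure_C_qc_subset:
  assumes "C_of_type U t \<subseteq> closure (C_qc (U :: 'u itself) :: (3, 2) corr set)"
  shows "Theta U t \<subseteq> region upper_q"
proof
  fix x assume "x \<in> Theta U t"
  then obtain p where p: "p \<in> closure (C_qc U)" "synchronous p" "x = (theta p, theta_tilde p)"
    using assms by (auto simp: Theta_def C_sync_def)
  interpret sync_correlation p by (rule closure_C_qc_sync_correlation[OF p(1,2)])
  show "x \<in> region upper_q"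
    using basic_bounds tracial_bounds[OF p(1)] by (simp add: p(3) region_def upper_q_def)
qed

lemma Theta_tvect_subset: "Theta (U :: 'u itself) tvect \<subseteq> region upper_vect"
proof
  fix x assume "x \<in> Theta U tvect"
  then obtain p where p: "p \<in> C_vect U" "synchronous p" "x = (theta p, theta_tilde p)"
    by (auto simp: Theta_def C_sync_def)
  then have "correlation p" by (simp add: C_vect_def)
  then interpret sync_correlation p
    using p C_vect_no_signalling by unfold_locales auto
  show "x \<in> region upper_vect"
    using basic_bounds vector_bound[OF p(1)] by (simp add: p(3) region_def upper_vect_def)
qed

context universe
begin

text \<open>The region is the convex hull of the five points realised by
  \<open>Theta_tq_intro\<close>; each case finds the weights in one part of it.\<close>

lemma region_subset_Theta_tq: "region upper_q \<subseteq> Theta (U :: 'u itself) tq"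
proof (rule subsetI, safe)
  fix \<theta> s assume "(\<theta>, s) \<in> region upper_q"
  then have b: "0 \<le> \<theta>" "\<theta> \<le> 1" "1 / 2 \<le> s" "s \<le> 1 / 2 + \<theta>" "s \<le> 3 / 2 - \<theta>"
    "s \<le> (3 + \<theta>) / 4" "s \<le> (4 - \<theta>) / 4"
    by (auto simp: region_def upper_q_def)
  consider "\<theta> \<le> 1 / 3" | "1 / 3 \<le> \<theta>" "\<theta> \<le> 1 / 2" | "1 / 2 \<le> \<theta>" "\<theta> \<le> 2 / 3" | "2 / 3 \<le> \<theta>"
    by linarith
  then show "(\<theta>, s) \<in> Theta U tq"
  proof cases
    case 1
    show ?thesis
      \<comment> \<open>Barycentric coordinates in the triangle (1, 1/2), (0, 1/2), (1/3,
        5/6).\<close>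
      by (rule Theta_tq_intro[of "\<theta> - (s - 1 / 2)" "1 - \<theta> - 2 * (s - 1 / 2)" "3 * (s - 1 / 2)" 0 0])
        (use b 1 in \<open>simp_all add: algebra_simps\<close>)
  next
    case 2
    \<comment> \<open>Relative height of s between 1/2 and the upper edge. The top point mixes (1/3,
      5/6) and (1/2, 7/8) with weights 3 - 6 \<theta> and 6 \<theta> - 2, the bottom point mixes the
      constant strategies.\<close>
    define \<rho> where "\<rho> = (4 * s - 2) / (1 + \<theta>)"
    have \<rho>: "0 \<le> \<rho>" "\<rho> \<le> 1" "\<rho> * (1 + \<theta>) = 4 * s - 2"
      using b by (simp_all add: \<rho>_def)
    show ?thesis
      by (rule Theta_tq_intro[of "(1 - \<rho>) * \<theta>" "(1 - \<rho>) * (1 - \<theta>)" "\<rho> * (3 - 6 * \<theta>)" 0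
            "\<rho> * (6 * \<theta> - 2)"])
        (use b 2 \<rho>(1,2) in simp, use b 2 \<rho>(1,2) in simp, use b 2 \<rho>(1,2) in simp,
          use b 2 \<rho>(1,2) in simp, use b 2 \<rho>(1,2) in simp, use \<rho>(3) in \<open>simp_all add: algebra_simps\<close>)
  next
    case 3
    define \<rho> where "\<rho> = (4 * s - 2) / (2 - \<theta>)"
    have \<rho>: "0 \<le> \<rho>" "\<rho> \<le> 1" "\<rho> * (2 - \<theta>) = 4 * s - 2"
      using b by (simp_all add: \<rho>_def)
    show ?thesis
      by (rule Theta_tq_intro[of "(1 - \<rho>) * \<theta>" "(1 - \<rho>) * (1 - \<theta>)" 0 "\<rho> * (6 * \<theta> - 3)"
            "\<rho> * (4 - 6 * \<theta>)"])
        (use b 3 \<rho>(1,2) in simp, use b 3 \<rho>(1,2) in simp, use b 3 \<rho>(1,2) in simp,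
          use b 3 \<rho>(1,2) in simp, use b 3 \<rho>(1,2) in simp, use \<rho>(3) in \<open>simp_all add: algebra_simps\<close>)
  next
    case 4
    show ?thesis
      by (rule Theta_tq_intro[of "\<theta> - 2 * (s - 1 / 2)" "1 - \<theta> - (s - 1 / 2)" 0 "3 * (s - 1 / 2)" 0])
        (use b 4 in \<open>simp_all add: algebra_simps\<close>)
  qed
qed

text \<open>For c = 1/2 + \<theta> - s the conditions of \<open>Theta_tvect_intro\<close> are
  exactly the bounds on s defining the region.\<close>

lemma region_subset_Theta_tvect: "region upper_vect \<subseteq> Theta (U :: 'u itself) tvect"
proof (rule subsetI, safe)
  fix \<theta> s assume "(\<theta>, s) \<in> region upper_vect"
  then show "(\<theta>, s) \<in> Theta U tvect"
    using Theta_tvect_intro[of "1 / 2 + \<theta> - s" \<theta>]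
    by (simp add: region_def upper_vect_def)
qed

lemma Theta_eq_region:
  "Theta (U :: 'u itself) tq = region upper_q" "Theta U tqa = region upper_q"
  "Theta U tqc = region upper_q" "Theta U tvect = region upper_vect"
proof -
  have sub: "C_q U \<subseteq> (C_qc U :: (3, 2) corr set)" by (rule C_q_subset_C_qc)
  have "Theta U tqa \<subseteq> region upper_q"
    by (rule Theta_closure_C_qc_subset) (simp add: C_qa_def closure_mono sub)
  then show qa: "Theta U tq = region upper_q" "Theta U tqa = region upper_q"
    using Theta_tq_subset_tqa[of U] region_subset_Theta_tq[of U] by auto
  have "Theta U tq \<subseteq> Theta U tqc"
    using sub by (fastforce simp: Theta_def C_sync_def)
  moreover have "Theta U tqc \<subseteq> region upper_q"
    by (rule Theta_closure_C_qc_subset) (simp add: closure_subset)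
  ultimately show "Theta U tqc = region upper_q" using qa by auto
  show "Theta U tvect = region upper_vect"
    using Theta_tvect_subset region_subset_Theta_tvect by blast
qed

end

section \<open>Comparison and explicit pieces of the boundary functions\<close>

lemma upper_q_ge_half: "0 \<le> \<theta> \<Longrightarrow> \<theta> \<le> 1 \<Longrightarrow> 1 / 2 \<le> upper_q \<theta>"
  by (simp add: upper_q_def)

text \<open>On [0, 1] \<open>upper_q\<close> is the piecewise linear interpolation of the concave
  parabola Q at 0, 1/3, 1/2, 2/3, 1. The product in each form of Q is the interpolation error,
  nonnegative between its two nodes.\<close>

lemma upper_q_le_upper_vect:
  assumes "0 \<le> \<theta>" "\<theta> \<le> 1"
  shows "upper_q \<theta> \<le> upper_vect \<theta>"
proof -
  define Q where "Q = (1 + 3 * \<theta> - 3 * \<theta>\<^sup>2) / 2"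
  have Q: "Q = 1 / 2 + \<theta> + \<theta> * (1 - 3 * \<theta>) / 2" "Q = (3 + \<theta>) / 4 + (3 * \<theta> - 1) * (1 - 2 * \<theta>) / 4"
    "Q = (4 - \<theta>) / 4 + (2 * \<theta> - 1) * (2 - 3 * \<theta>) / 4" "Q = 3 / 2 - \<theta> + (1 - \<theta>) * (3 * \<theta> - 2) / 2"
    by (simp_all add: Q_def algebra_simps add_divide_distrib diff_divide_distrib power2_eq_square)
  have u: "upper_q \<theta> \<le> 1 / 2 + \<theta>" "upper_q \<theta> \<le> (3 + \<theta>) / 4"
    "upper_q \<theta> \<le> (4 - \<theta>) / 4" "upper_q \<theta> \<le> 3 / 2 - \<theta>"
    unfolding upper_q_def
    by (intro min.coboundedI1[OF min.cobounded1] min.coboundedI1[OF min.cobounded2]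
        min.coboundedI2[OF min.cobounded1] min.coboundedI2[OF min.cobounded2])+
  have "upper_q \<theta> \<le> Q"
  proof -
    consider "\<theta> \<le> 1 / 3" | "1 / 3 \<le> \<theta>" "\<theta> \<le> 1 / 2" | "1 / 2 \<le> \<theta>" "\<theta> \<le> 2 / 3" | "2 / 3 \<le> \<theta>"
      by linarith
    then show ?thesis
    proof cases
      case 1
      then have "0 \<le> \<theta> * (1 - 3 * \<theta>)" using assms by simp
      then show ?thesis using Q(1) u(1) by linarith
    next
      case 2
      then have "0 \<le> (3 * \<theta> - 1) * (1 - 2 * \<theta>)" by simp
      then show ?thesis using Q(2) u(2) by linarith
    next
      case 3
      then have "0 \<le> (2 * \<theta> - 1) * (2 - 3 * \<theta>)" by simp
      then show ?thesis using Q(3) u(3) by linarith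
    next
      case 4
      then have "0 \<le> (1 - \<theta>) * (3 * \<theta> - 2)" using assms by simp
      then show ?thesis using Q(4) u(4) by linarith
    qed
  qed
  then show ?thesis using u by (simp add: upper_vect_def Q_def)
qed

lemma upper_q_eq:
  "\<theta> \<le> 1 / 3 \<Longrightarrow> upper_q \<theta> = 1 / 2 + \<theta>"
  "1 / 3 \<le> \<theta> \<Longrightarrow> \<theta> \<le> 1 / 2 \<Longrightarrow> upper_q \<theta> = (3 + \<theta>) / 4"
  "1 / 2 \<le> \<theta> \<Longrightarrow> \<theta> \<le> 2 / 3 \<Longrightarrow> upper_q \<theta> = (4 - \<theta>) / 4"
  "2 / 3 \<le> \<theta> \<Longrightarrow> upper_q \<theta> = 3 / 2 - \<theta>"
  by (auto simp: upper_q_def min_def)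

lemma upper_vect_eq:
  "0 \<le> \<theta> \<Longrightarrow> \<theta> \<le> 1 / 3 \<Longrightarrow> upper_vect \<theta> = 1 / 2 + \<theta>"
  "1 / 3 \<le> \<theta> \<Longrightarrow> \<theta> \<le> 2 / 3 \<Longrightarrow> upper_vect \<theta> = (1 + 3 * \<theta> - 3 * \<theta>\<^sup>2) / 2"
  "2 / 3 \<le> \<theta> \<Longrightarrow> \<theta> \<le> 1 \<Longrightarrow> upper_vect \<theta> = 3 / 2 - \<theta>"
proof -
  define Q where "Q = (1 + 3 * \<theta> - 3 * \<theta>\<^sup>2) / 2"
  have upper: "upper_vect \<theta> = min (1 / 2 + \<theta>) (min Q (3 / 2 - \<theta>))"
    by (simp add: upper_vect_def Q_def)
  have Q: "Q = 1 / 2 + \<theta> + \<theta> * (1 - 3 * \<theta>) / 2" "Q = 3 / 2 - \<theta> + (1 - \<theta>) * (3 * \<theta> - 2) / 2"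
    by (simp_all add: Q_def algebra_simps add_divide_distrib diff_divide_distrib power2_eq_square)
  show "upper_vect \<theta> = 1 / 2 + \<theta>" if "0 \<le> \<theta>" "\<theta> \<le> 1 / 3"
  proof -
    have "0 \<le> \<theta> * (1 - 3 * \<theta>)" using that by simp
    then have "1 / 2 + \<theta> \<le> Q" "1 / 2 + \<theta> \<le> 3 / 2 - \<theta>" using Q(1) that by linarith+
    then show ?thesis unfolding upper by (intro min_absorb1 min.boundedI)
  qed
  show "upper_vect \<theta> = (1 + 3 * \<theta> - 3 * \<theta>\<^sup>2) / 2" if "1 / 3 \<le> \<theta>" "\<theta> \<le> 2 / 3"
  proof -
    have "\<theta> * (1 - 3 * \<theta>) \<le> 0" "(1 - \<theta>) * (3 * \<theta> - 2) \<le> 0"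
      using that by (auto intro: mult_nonneg_nonpos)
    then have "Q \<le> 1 / 2 + \<theta>" "Q \<le> 3 / 2 - \<theta>" using Q by linarith+
    then show ?thesis unfolding upper Q_def[symmetric] by linarith
  qed
  show "upper_vect \<theta> = 3 / 2 - \<theta>" if "2 / 3 \<le> \<theta>" "\<theta> \<le> 1"
  proof -
    have "0 \<le> (1 - \<theta>) * (3 * \<theta> - 2)" using that by simp
    then have "3 / 2 - \<theta> \<le> Q" "3 / 2 - \<theta> \<le> 1 / 2 + \<theta>" using Q(2) that by linarith+
    then show ?thesis unfolding upper by linarith
  qed
qed

lemma region_upper_q_psubset: "region upper_q \<subset> region upper_vect"
proof
  show "region upper_q \<subseteq> region upper_vect"
    using upper_q_le_upper_vect by (force simp: region_def)
  \<comment> \<open>The midpoint of [1/3, 1/2]: the parabola has the value 83/96 there and the chord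
    82/96.\<close>
  have "(5 / 12, 83 / 96) \<in> region upper_vect" "(5 / 12, 83 / 96) \<notin> region upper_q"
    by (simp_all add: region_def upper_q_def upper_vect_def power2_eq_square)
  then show "region upper_q \<noteq> region upper_vect" by blast
qed

theorem theorem3p1:
  fixes U :: "'u itself"
  assumes universe: "\<exists>e :: (nat \<Rightarrow> complex) \<Rightarrow> 'u. inj e"
  shows
    "(\<forall>t\<in>{tq, tqa, tqc}. \<forall>\<theta>\<in>{0..1}.
        f_lower U t \<theta> = 1 / 2 \<and>
        (0 \<le> \<theta> \<and> \<theta> \<le> 1 / 3 \<longrightarrow> f_upper U t \<theta> = 1 / 2 + \<theta>) \<and>
        (1 / 3 \<le> \<theta> \<and> \<theta> \<le> 1 / 2 \<longrightarrow> f_upper U t \<theta> = (3 + \<theta>) / 4) \<and>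
        (1 / 2 \<le> \<theta> \<and> \<theta> \<le> 2 / 3 \<longrightarrow> f_upper U t \<theta> = (4 - \<theta>) / 4) \<and>
        (2 / 3 \<le> \<theta> \<and> \<theta> \<le> 1 \<longrightarrow> f_upper U t \<theta> = 3 / 2 - \<theta>)) \<and>
     (\<forall>\<theta>\<in>{0..1}.
        f_lower U tvect \<theta> = 1 / 2 \<and>
        (0 \<le> \<theta> \<and> \<theta> \<le> 1 / 3 \<longrightarrow> f_upper U tvect \<theta> = 1 / 2 + \<theta>) \<and>
        (1 / 3 \<le> \<theta> \<and> \<theta> \<le> 2 / 3 \<longrightarrow> f_upper U tvect \<theta> = (1 + 3 * \<theta> - 3 * \<theta>\<^sup>2) / 2) \<and>
        (2 / 3 \<le> \<theta> \<and> \<theta> \<le> 1 \<longrightarrow> f_upper U tvect \<theta> = 3 / 2 - \<theta>)) \<and>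
     (\<forall>t\<in>{tq, tqa, tqc, tvect}. \<forall>\<theta>\<in>{0..1}.
        (\<theta>, f_upper U t \<theta>) \<in> Theta U t \<and> (\<theta>, f_lower U t \<theta>) \<in> Theta U t) \<and>
     (\<forall>t\<in>{tq, tqa, tqc, tvect}. \<forall>\<theta> s.
        (\<theta>, s) \<in> Theta U t \<longleftrightarrow>
          0 \<le> \<theta> \<and> \<theta> \<le> 1 \<and> f_lower U t \<theta> \<le> s \<and> s \<le> f_upper U t \<theta>) \<and>
     (\<forall>t\<in>{tq, tqa, tqc, tvect}. closed (Theta U t)) \<and>
     Theta U tq = Theta U tqa \<and> Theta U tqa = Theta U tqc \<and> Theta U tqc \<subset> Theta U tvect"
proof -
  obtain e :: "(nat \<Rightarrow> complex) \<Rightarrow> 'u" where "inj e" using universe by blast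
  then interpret universe e by unfold_locales
  note Theta_eq = Theta_eq_region[of U]
  define F where "F t = (if t = tvect then upper_vect else upper_q)" for t
  have Theta_F: "Theta U t = region (F t)" for t
    by (cases t) (simp_all add: F_def Theta_eq)
  have half: "1 / 2 \<le> F t \<theta>" if "0 \<le> \<theta>" "\<theta> \<le> 1" for t \<theta>
    using upper_q_ge_half[OF that] upper_q_le_upper_vect[OF that] by (simp add: F_def)
  have f: "f_upper U t \<theta> = F t \<theta>" "f_lower U t \<theta> = 1 / 2" if "0 \<le> \<theta>" "\<theta> \<le> 1" for t \<theta>
    using f_upper_lower_region[OF Theta_F] that half by auto
  have mem: "(\<theta>, s) \<in> Theta U t \<longleftrightarrow> 0 \<le> \<theta> \<and> \<theta> \<le> 1 \<and> f_lower U t \<theta> \<le> s \<and> s \<le> f_upper U t \<theta>"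
    for t \<theta> s
    using f[of \<theta> t] by (auto simp: Theta_F region_def)
  have "continuous_on UNIV (F t)" for t
    by (auto simp: F_def upper_q_def[abs_def] upper_vect_def[abs_def] intro!: continuous_intros)
  then have closed: "closed (Theta U t)" for t
    unfolding Theta_F by (rule closed_region)
  have upper: "f_upper U t \<theta> = upper_q \<theta>" if "t \<noteq> tvect" "0 \<le> \<theta>" "\<theta> \<le> 1" for t \<theta>
    using f that by (simp add: F_def)
  have upper': "f_upper U tvect \<theta> = upper_vect \<theta>" if "0 \<le> \<theta>" "\<theta> \<le> 1" for \<theta>
    using f that by (simp add: F_def)
  have attained: "(\<theta>, f_upper U t \<theta>) \<in> Theta U t \<and> (\<theta>, f_lower U t \<theta>) \<in> Theta U t"
    if "\<theta> \<in> {0..1}" for t \<theta>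
    using that f[of \<theta> t] half[of \<theta> t] by (simp add: mem)
  have 1: "\<forall>t\<in>{tq, tqa, tqc}. \<forall>\<theta>\<in>{0..1}.
        f_lower U t \<theta> = 1 / 2 \<and>
        (0 \<le> \<theta> \<and> \<theta> \<le> 1 / 3 \<longrightarrow> f_upper U t \<theta> = 1 / 2 + \<theta>) \<and>
        (1 / 3 \<le> \<theta> \<and> \<theta> \<le> 1 / 2 \<longrightarrow> f_upper U t \<theta> = (3 + \<theta>) / 4) \<and>
        (1 / 2 \<le> \<theta> \<and> \<theta> \<le> 2 / 3 \<longrightarrow> f_upper U t \<theta> = (4 - \<theta>) / 4) \<and>
        (2 / 3 \<le> \<theta> \<and> \<theta> \<le> 1 \<longrightarrow> f_upper U t \<theta> = 3 / 2 - \<theta>)"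
    by (auto simp: f(2) upper upper_q_eq)
  have 2: "\<forall>\<theta>\<in>{0..1}.
        f_lower U tvect \<theta> = 1 / 2 \<and>
        (0 \<le> \<theta> \<and> \<theta> \<le> 1 / 3 \<longrightarrow> f_upper U tvect \<theta> = 1 / 2 + \<theta>) \<and>
        (1 / 3 \<le> \<theta> \<and> \<theta> \<le> 2 / 3 \<longrightarrow> f_upper U tvect \<theta> = (1 + 3 * \<theta> - 3 * \<theta>\<^sup>2) / 2) \<and>
        (2 / 3 \<le> \<theta> \<and> \<theta> \<le> 1 \<longrightarrow> f_upper U tvect \<theta> = 3 / 2 - \<theta>)"
    by (auto simp: f(2) upper' upper_vect_eq)
  show ?thesis
    using 1 2 attained mem closed Theta_eq region_upper_q_psubset by simp
qed

end
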